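(* Let $\mathcal{C}$ be a class of left-r.e. reals. Assume that $\mathcal{C}$ has a shift-persistent element and that $\mathcal{C}$ does not contain all infinite left-r.e. reals $R$ with $0 < R < 1$. Then $\mathcal{C}$ does not have an acceptable left-r.e. numbering.
   Context: A real is an infinite binary sequence, identified with the number in $[0,1]$ having that binary expansion. A real is left-r.e. if it is the limit of a recursive nondecreasing sequence of rationals; equivalently it equals $\sum_{x\in \operatorname{dom}\psi} 2^{-|x|}$ for some partial recursive $\psi$, where $|x|=\lceil\log(x+1)\rceil$. A real is called infinite if its binary expansion contains infinitely many 0's and infinitely many 1's. A real $X$ is a shift-persistent element of $\mathcal{C}$ if $\sigma^\frown X\in\mathcal{C}$ for every finite binary string $\sigma$. A (partial recursive) numbering is a partial recursive function $\langle e,x\rangle\mapsto\varphi_e(x)$. A left-r.e. numbering is a map $e\mapsto\alpha_e=\sum_{x\in\operatorname{dom}\varphi_e}2^{-|x|}$ for some numbering $\varphi$; it is a left-r.e. numbering of $\mathcal{C}$ if its range is $\mathcal{C}$. A left-r.e. numbering $\alpha$ of $\mathcal{C}$ is acceptable if for every left-r.e. numbering $\beta$ (of members of $\mathcal{C}$) there is a recursive function $f$ with $\alpha_{f(e)}=\beta_e$ for all $e$. *)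

theory Defs
  imports "HOL-Analysis.Analysis" "HOL-Library.Omega_Words_Fun"
begin

section \<open>Partial recursive functions\<close>

text \<open>Kleene's \<open>\<mu>\<close>-recursive function expressions with their big-step semantics:
  \<open>evaluates r xs y\<close> means that \<open>r\<close> converges on the argument tuple \<open>xs\<close> with value \<open>y\<close>.
  Arities are not part of the syntax: \<open>Zero\<close> and \<open>Proj i\<close> serve all arities they make sense for,
  and on an argument tuple of unsuitable length an expression has no value. The recursion variable of
  \<open>PrimRec\<close> and the search variable of \<open>Mu\<close> come first.\<close>

datatype recf = Zero | Succ | Proj nat | Comp recf "recf list" | PrimRec recf recf | Mu recf

inductive evaluates :: "recf \<Rightarrow> nat list \<Rightarrow> nat \<Rightarrow> bool" where
  zero: "evaluates Zero xs 0"
| succ: "evaluates Succ [x] (Suc x)"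
| proj: "i < length xs \<Longrightarrow> evaluates (Proj i) xs (xs ! i)"
| comp: "length ys = length gs \<Longrightarrow> (\<forall>i<length gs. evaluates (gs ! i) xs (ys ! i)) \<Longrightarrow>
    evaluates f ys z \<Longrightarrow> evaluates (Comp f gs) xs z"
| primrec_0: "evaluates f xs y \<Longrightarrow> evaluates (PrimRec f g) (0 # xs) y"
| primrec_Suc: "evaluates (PrimRec f g) (n # xs) y \<Longrightarrow> evaluates g (n # y # xs) z \<Longrightarrow>
    evaluates (PrimRec f g) (Suc n # xs) z"
| mu: "evaluates f (n # xs) 0 \<Longrightarrow> (\<forall>m<n. \<exists>y. evaluates f (m # xs) (Suc y)) \<Longrightarrow>
    evaluates (Mu f) xs n"

definition partial_recursive :: "nat \<Rightarrow> (nat list \<rightharpoonup> nat) \<Rightarrow> bool" where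
  "partial_recursive k F \<longleftrightarrow>
    (\<exists>r. \<forall>xs. length xs = k \<longrightarrow> (\<forall>y. F xs = Some y \<longleftrightarrow> evaluates r xs y))"

definition recursive :: "(nat \<Rightarrow> nat) \<Rightarrow> bool" where
  "recursive f \<longleftrightarrow> partial_recursive 1 (\<lambda>xs. Some (f (xs ! 0)))"

definition numbering :: "(nat \<Rightarrow> nat \<rightharpoonup> nat) \<Rightarrow> bool" where
  "numbering \<phi> \<longleftrightarrow> partial_recursive 2 (\<lambda>xs. \<phi> (xs ! 0) (xs ! 1))"


section \<open>Reals as binary sequences\<close>

text \<open>A binary sequence is identified with its value in \<open>[0,1]\<close>; in particular the two
  expansions of a dyadic rational denote the same real. Prefixing by a finite string respects
  this identification, and a real with an expansion having infinitely many zeros and ones has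
  no other expansion. So below it does not matter which expansion is chosen.\<close>

definition bin_real :: "(nat \<Rightarrow> bool) \<Rightarrow> real" where
  "bin_real X = (\<Sum>n. of_bool (X n) / 2 ^ Suc n)"

definition infinite_real :: "real \<Rightarrow> bool" where
  "infinite_real r \<longleftrightarrow> (\<exists>X. r = bin_real X \<and> infinite {n. \<not> X n} \<and> infinite {n. X n})"

definition shift_persistent :: "real set \<Rightarrow> real \<Rightarrow> bool" where
  "shift_persistent C r \<longleftrightarrow> (\<exists>X. r = bin_real X \<and> (\<forall>\<sigma>. bin_real (\<sigma> \<frown> X) \<in> C))"


section \<open>Left-r.e. reals and left-r.e. numberings\<close>

text \<open>Recursiveness of a sequence of rationals refers to the effective enumeration
  \<^const>\<open>nat_to_rat_surj\<close> of all rationals as fractions of integers.\<close>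

definition recursive_rat_seq :: "(nat \<Rightarrow> rat) \<Rightarrow> bool" where
  "recursive_rat_seq q \<longleftrightarrow> (\<exists>f. recursive f \<and> (\<forall>n. q n = nat_to_rat_surj (f n)))"

definition left_re :: "real \<Rightarrow> bool" where
  "left_re r \<longleftrightarrow> r \<in> {0..1} \<and>
    (\<exists>q. recursive_rat_seq q \<and> mono q \<and> (\<lambda>n. real_of_rat (q n)) \<longlonglongrightarrow> r)"

definition len :: "nat \<Rightarrow> nat" where
  "len x = nat \<lceil>log 2 (real x + 1)\<rceil>"

text \<open>The weights of all natural numbers together have infinite sum, so convergence of the sum
  over the domain (to a value in \<open>[0,1]\<close>) is part of being a left-r.e. numbering.\<close>

definition left_re_numbering :: "(nat \<Rightarrow> real) \<Rightarrow> bool" where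
  "left_re_numbering \<alpha> \<longleftrightarrow> (\<exists>\<phi>. numbering \<phi> \<and>
    (\<forall>e. \<alpha> e \<in> {0..1} \<and> ((\<lambda>x. 1 / 2 ^ len x) has_sum \<alpha> e) (dom (\<phi> e))))"

definition left_re_numbering_of :: "real set \<Rightarrow> (nat \<Rightarrow> real) \<Rightarrow> bool" where
  "left_re_numbering_of C \<alpha> \<longleftrightarrow> left_re_numbering \<alpha> \<and> range \<alpha> = C"

definition acceptable_left_re_numbering_of :: "real set \<Rightarrow> (nat \<Rightarrow> real) \<Rightarrow> bool" where
  "acceptable_left_re_numbering_of C \<alpha> \<longleftrightarrow> left_re_numbering_of C \<alpha> \<and>
    (\<forall>\<beta>. left_re_numbering \<beta> \<and> range \<beta> \<subseteq> C \<longrightarrow>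
      (\<exists>f. recursive f \<and> (\<forall>e. \<alpha> (f e) = \<beta> e)))"

end

theory Submission
  imports Defs
begin

text \<open>Suppose \<open>\<alpha>\<close> is an acceptable numbering of \<open>C\<close>, let \<open>X\<close> be shift-persistent and let \<open>R > 0\<close> be a
  left-r.e. real outside \<open>C\<close>. Cutting off approximations of \<open>R\<close> from below and appending \<open>X\<close> gives
  members \<open>\<tau> 0, \<tau> 1, \<dots>\<close> of \<open>C\<close> below \<open>R\<close> which converge to \<open>R\<close>. Define \<open>\<beta> e\<close> in phases: during
  phase \<open>p\<close> it approximates the maximum of \<open>\<tau> 0, \<dots>, \<tau> p\<close>, and phase \<open>p\<close> ends as soon as the \<open>e\<close>-th
  partial recursive function has been seen to converge on \<open>e\<close>, to \<open>i\<close> say, and the current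
  approximations of \<open>\<alpha> i\<close> and \<open>\<beta> e\<close> differ by less than \<open>1 / 2 ^ p\<close>. Infinitely many phases would
  give \<open>\<alpha> i = \<beta> e = R\<close>, which is not in \<open>C\<close>. So there are only finitely many, whence \<open>\<beta> e\<close> is one of
  the \<open>\<tau> n\<close> and lies in \<open>C\<close>, but differs from \<open>\<alpha> i\<close>. Hence no recursive function reduces
  \<open>\<beta>\<close> to \<open>\<alpha>\<close>.\<close>

section \<open>Closure properties of recursive functions\<close>

lemma evaluates_CompD: "evaluates (Comp f gs) xs z \<Longrightarrow>
    \<exists>ys. length ys = length gs \<and> (\<forall>i<length gs. evaluates (gs ! i) xs (ys ! i)) \<and> evaluates f ys z"
  by (erule evaluates.cases) (simp_all, fast)

lemma evaluates_MuD: "evaluates (Mu f) xs z \<Longrightarrow>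
    evaluates f (z # xs) 0 \<and> (\<forall>m<z. \<exists>y. evaluates f (m # xs) (Suc y))"
  by (erule evaluates.cases) simp_all

text \<open>\<open>partial_recursive\<close> asks for an equivalence, so an expression that yields
  the right value must also be shown to yield no other. In the case of \<open>Mu\<close>, at the
  smaller of two different results the searched function would take both the value zero and a
  positive value.\<close>

lemma evaluates_deterministic: "evaluates r xs y \<Longrightarrow> evaluates r xs z \<Longrightarrow> y = z"
proof (induction arbitrary: z rule: evaluates.induct)
  case (comp ys gs xs f y)
  obtain ys' where ys': "length ys' = length gs"
    "\<forall>i<length gs. evaluates (gs ! i) xs (ys' ! i)" "evaluates f ys' z"
    using evaluates_CompD[OF comp.prems] by blast
  have "ys ! i = ys' ! i" if "i < length gs" for i
    using that comp.IH(1)[rule_format, OF that] ys'(2)[rule_format, OF that] by metis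
  then have "ys = ys'"
    using comp.hyps(1) ys'(1) by (simp add: list_eq_iff_nth_eq)
  then show ?case
    using comp.IH(2)[of z] ys'(3) by metis
next
  case (primrec_Suc f g n xs y w)
  from primrec_Suc.prems show ?case
  proof cases
    case (primrec_Suc y')
    then show ?thesis
      using primrec_Suc.IH(1)[of y'] primrec_Suc.IH(2)[of z] by metis
  qed
next
  case (mu f n xs)
  have z: "evaluates f (z # xs) 0" "\<forall>m<z. \<exists>y. evaluates f (m # xs) (Suc y)"
    using evaluates_MuD[OF mu.prems] by metis+
  show ?case
  proof (rule linorder_cases[of n z])
    assume "n < z"
    with z(2) obtain y where "evaluates f (n # xs) (Suc y)" by metis
    then show ?thesis using mu.IH(1)[of "Suc y"] by simp
  next
    assume "z < n"
    then obtain y where "\<forall>w. evaluates f (z # xs) w \<longrightarrow> Suc y = w" using mu.IH(2) by metis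
    with z(1) show ?thesis by (metis nat.distinct(1))
  qed
next
  case (primrec_0 f xs y g)
  from primrec_0.prems show ?case
    by cases (rule primrec_0.IH)
next
  case (proj i xs)
  from proj.prems show ?case by cases simp
next
  case (succ x)
  from succ.prems show ?case by cases simp
next
  case (zero xs)
  from zero.prems show ?case by cases simp
qed

text \<open>Composition is proved once for all arities in this form. Two-argument functions without
  lists are a special case, and later everything is reduced to unary functions, with further
  arguments packed into pairs.\<close>

definition recn :: "nat \<Rightarrow> (nat list \<Rightarrow> nat) \<Rightarrow> bool" where
  "recn k F \<longleftrightarrow> (\<exists>r. \<forall>xs. length xs = k \<longrightarrow> evaluates r xs (F xs))"

definition recursive2 :: "(nat \<Rightarrow> nat \<Rightarrow> nat) \<Rightarrow> bool" where
  "recursive2 F \<longleftrightarrow> (\<exists>r. \<forall>x y. evaluates r [x, y] (F x y))"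

lemma recursive_iff: "recursive f \<longleftrightarrow> (\<exists>r. \<forall>x. evaluates r [x] (f x))"
proof
  assume "recursive f"
  then show "\<exists>r. \<forall>x. evaluates r [x] (f x)"
    unfolding recursive_def partial_recursive_def
    by (metis length_Cons list.size(3) nth_Cons_0 One_nat_def)
next
  assume "\<exists>r. \<forall>x. evaluates r [x] (f x)"
  then obtain r where r: "\<forall>x. evaluates r [x] (f x)" by blast
  then have "Some (f x) = Some y \<longleftrightarrow> evaluates r [x] y" for x y
    using evaluates_deterministic[of r "[x]" y "f x"] by auto
  then show "recursive f"
    unfolding recursive_def partial_recursive_def
    by (intro exI[of _ r]) (auto simp: length_Suc_conv)
qed

lemma recursive_eqI: "recursive f \<Longrightarrow> (\<And>x. f x = g x) \<Longrightarrow> recursive g"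
  by (metis ext)

lemma recursive2_eqI: "recursive2 f \<Longrightarrow> (\<And>x y. f x y = g x y) \<Longrightarrow> recursive2 g"
  by (metis ext)

lemma recn_compose1:
  assumes "recursive F" "recn k f"
  shows "recn k (\<lambda>xs. F (f xs))"
proof -
  from assms obtain rF rf where *: "\<And>x. evaluates rF [x] (F x)"
    "\<And>xs. length xs = k \<Longrightarrow> evaluates rf xs (f xs)"
    unfolding recursive_iff recn_def by metis
  have "evaluates (Comp rF [rf]) xs (F (f xs))" if "length xs = k" for xs
    by (rule evaluates.comp[where ys = "[f xs]"]) (auto simp: * that)
  then show ?thesis
    unfolding recn_def by blast
qed

lemma recn_compose2:
  assumes "recursive2 F" "recn k f" "recn k g"
  shows "recn k (\<lambda>xs. F (f xs) (g xs))"
proof -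
  from assms obtain rF rf rg where *: "\<And>x y. evaluates rF [x, y] (F x y)"
    "\<And>xs. length xs = k \<Longrightarrow> evaluates rf xs (f xs)"
    "\<And>xs. length xs = k \<Longrightarrow> evaluates rg xs (g xs)"
    unfolding recursive2_def recn_def by metis
  have "evaluates (Comp rF [rf, rg]) xs (F (f xs) (g xs))" if "length xs = k" for xs
    by (rule evaluates.comp[where ys = "[f xs, g xs]"]) (auto simp: * that less_Suc_eq)
  then show ?thesis
    unfolding recn_def by blast
qed

lemma recn_nth: "i < k \<Longrightarrow> recn k (\<lambda>xs. xs ! i)"
  unfolding recn_def using evaluates.proj by blast

lemma recn_const: "recn k (\<lambda>xs. c)"
proof (induction c)
  case 0
  then show ?case unfolding recn_def using evaluates.zero by blast
next
  case (Suc c)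
  have "recursive Suc"
    unfolding recursive_iff using evaluates.succ by blast
  from recn_compose1[OF this Suc] show ?case .
qed

lemma recursive_recn: "recursive f \<longleftrightarrow> recn 1 (\<lambda>xs. f (xs ! 0))"
  unfolding recursive_iff recn_def
  by (intro arg_cong[where f = Ex] ext) (auto simp: length_Suc_conv)

lemma recursive2_recn: "recursive2 f \<longleftrightarrow> recn 2 (\<lambda>xs. f (xs ! 0) (xs ! 1))"
  unfolding recursive2_def recn_def
  by (intro arg_cong[where f = Ex] ext) (auto simp: length_Suc_conv numeral_2_eq_2 dest: spec[of _ "[_, _]"])

lemma recursive_rec_nat:
  assumes "recursive2 G"
  shows "recursive (\<lambda>n. rec_nat c G n)"
proof -
  obtain rc where c: "evaluates rc [] c"
    using recn_const[of 0 c] unfolding recn_def by auto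
  obtain rg where g: "\<And>x y. evaluates rg [x, y] (G x y)"
    using assms unfolding recursive2_def by blast
  have "evaluates (PrimRec rc rg) [n] (rec_nat c G n)" for n
    by (induction n) (auto intro: evaluates.primrec_0 evaluates.primrec_Suc c g)
  then show ?thesis
    unfolding recursive_iff by blast
qed

lemma recursive2_rec_nat:
  assumes "recursive f" "recn 3 (\<lambda>xs. G (xs ! 0) (xs ! 1) (xs ! 2))"
  shows "recursive2 (\<lambda>n x. rec_nat (f x) (\<lambda>i y. G i y x) n)"
proof -
  obtain rf where f: "\<And>x. evaluates rf [x] (f x)"
    using assms(1) unfolding recursive_iff by blast
  obtain rg where rg: "\<And>xs. length xs = 3 \<Longrightarrow> evaluates rg xs (G (xs ! 0) (xs ! 1) (xs ! 2))"
    using assms(2) unfolding recn_def by blast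
  have g: "evaluates rg [i, y, x] (G i y x)" for i y x
    using rg[of "[i, y, x]"] by simp
  have "evaluates (PrimRec rf rg) [n, x] (rec_nat (f x) (\<lambda>i y. G i y x) n)" for n x
    by (induction n) (auto intro: evaluates.primrec_0 evaluates.primrec_Suc f g)
  then show ?thesis
    unfolding recursive2_def by blast
qed

lemma recursive2_compose:
  "recursive2 F \<Longrightarrow> recursive f \<Longrightarrow> recursive g \<Longrightarrow> recursive (\<lambda>x. F (f x) (g x))"
  unfolding recursive_recn by (rule recn_compose2)

lemma recursive_compose: "recursive F \<Longrightarrow> recursive f \<Longrightarrow> recursive (\<lambda>x. F (f x))"
  unfolding recursive_recn[of f] recursive_recn[of "\<lambda>x. F (f x)"] by (rule recn_compose1)

named_theorems recursive_intros

lemma recursive_id [recursive_intros]: "recursive (\<lambda>x. x)"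
  unfolding recursive_recn by (rule recn_nth) simp

lemma recursive_const [recursive_intros]: "recursive (\<lambda>x. c)"
  unfolding recursive_recn by (rule recn_const)

lemma recursive_Suc [recursive_intros]: "recursive f \<Longrightarrow> recursive (\<lambda>x. Suc (f x))"
  by (rule recursive_compose[of Suc]) (auto simp: recursive_iff intro: evaluates.succ)

lemma recn_Suc: "recn k f \<Longrightarrow> recn k (\<lambda>x. Suc (f x))"
  by (intro recn_compose1[of Suc] recursive_Suc recursive_id)

lemma recursive2_add: "recursive2 (+)"
proof -
  have "recursive2 (\<lambda>n x. rec_nat x (\<lambda>i y. Suc y) n)"
    by (intro recursive2_rec_nat recursive_id recn_Suc recn_nth) simp
  moreover have "rec_nat x (\<lambda>i y. Suc y) n = n + x" for n x
    by (induction n) auto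
  ultimately show ?thesis by (rule recursive2_eqI)
qed

lemma recursive2_mult: "recursive2 (*)"
proof -
  have "recursive2 (\<lambda>n x. rec_nat 0 (\<lambda>i y. y + x) n)"
    by (intro recursive2_rec_nat recursive_const recn_compose2[OF recursive2_add] recn_nth) simp_all
  moreover have "rec_nat 0 (\<lambda>i y. y + x) n = n * x" for n x :: nat
    by (induction n) auto
  ultimately show ?thesis by (rule recursive2_eqI)
qed

lemma recursive_pred: "recursive (\<lambda>x. x - 1)"
proof -
  have "recursive (\<lambda>n. rec_nat 0 (\<lambda>i y. i) n)"
    by (intro recursive_rec_nat) (auto simp: recursive2_recn intro!: recn_nth)
  moreover have "rec_nat 0 (\<lambda>i y. i) n = n - 1" for n :: nat
    by (cases n) auto
  ultimately show ?thesis by simp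
qed

lemma recursive2_diff: "recursive2 (-)"
proof -
  have "recursive2 (\<lambda>n x. rec_nat x (\<lambda>i y. y - 1) n)"
    by (intro recursive2_rec_nat recursive_id recn_compose1[OF recursive_pred] recn_nth) simp
  moreover have "rec_nat x (\<lambda>i y. y - 1) n = x - n" for n x :: nat
    by (induction n) auto
  ultimately have "recursive2 (\<lambda>n x. x - n)" by (rule recursive2_eqI)
  \<comment> \<open>The recursion ran over the subtrahend, which had to come first; the arguments
    are swapped back.\<close>
  from recn_compose2[OF this recn_nth recn_nth, of 1 2 0] show ?thesis
    by (simp add: recursive2_recn)
qed

lemmas [recursive_intros] = recursive2_compose[OF recursive2_add]
  recursive2_compose[OF recursive2_mult] recursive2_compose[OF recursive2_diff]

lemma recursive_triangle: "recursive triangle"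
proof -
  have "recursive (\<lambda>n. rec_nat 0 (\<lambda>i y. y + Suc i) n)"
    by (intro recursive_rec_nat)
       (auto simp: recursive2_recn simp del: add_Suc_right
         intro!: recn_nth recn_Suc recn_compose2[OF recursive2_add])
  moreover have "rec_nat 0 (\<lambda>i y. y + Suc i) n = triangle n" for n :: nat
    by (induction n) auto
  ultimately show ?thesis by (rule recursive_eqI)
qed

section \<open>Pairing of natural numbers\<close>

abbreviation pair :: "nat \<Rightarrow> nat \<Rightarrow> nat" where
  "pair x y \<equiv> prod_encode (x, y)"

definition pfst :: "nat \<Rightarrow> nat" where
  "pfst z = fst (prod_decode z)"

definition psnd :: "nat \<Rightarrow> nat" where
  "psnd z = snd (prod_decode z)"

lemma pfst_pair [simp]: "pfst (pair x y) = x" and psnd_pair [simp]: "psnd (pair x y) = y"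
  by (auto simp: pfst_def psnd_def)

lemma pair_pfst_psnd [simp]: "pair (pfst z) (psnd z) = z"
  by (simp add: pfst_def psnd_def)

lemma recn_pair: "recn k f \<Longrightarrow> recn k g \<Longrightarrow> recn k (\<lambda>x. pair (f x) (g x))"
  unfolding prod_encode_def prod.case
  by (intro recn_compose2[OF recursive2_add] recn_compose1[OF recursive_triangle])

lemma recursive_pair [recursive_intros]:
  "recursive f \<Longrightarrow> recursive g \<Longrightarrow> recursive (\<lambda>x. pair (f x) (g x))"
  unfolding recursive_recn by (rule recn_pair)

lemma triangle_mono: "m \<le> n \<Longrightarrow> triangle m \<le> triangle n"
  by (induction n) (auto simp: le_Suc_eq)

text \<open>The antidiagonal containing \<open>z\<close> is found by counting the triangular numbers up to \<open>z\<close>.\<close>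

lemma recursive_pfst_plus_psnd: "recursive (\<lambda>z. pfst z + psnd z)"
proof -
  define D where "D n z = rec_nat 0 (\<lambda>i y. y + (1 - (triangle (Suc i) - z))) n" for n z :: nat
  have "recursive2 D"
    unfolding D_def
    by (intro recursive2_rec_nat recursive_const recn_nth recn_Suc recn_const
          recn_compose2[OF recursive2_add] recn_compose2[OF recursive2_diff]
          recn_compose1[OF recursive_triangle]) simp_all
  then have "recursive (\<lambda>z. D z z)"
    by (intro recursive2_compose[of D] recursive_id)
  moreover have "D z z = pfst z + psnd z" for z
  proof -
    define s where "s = pfst z + psnd z"
    have z: "z = triangle s + pfst z"
      using pair_pfst_psnd[of z] unfolding s_def prod_encode_def by simp
    have "pfst z \<le> s" by (simp add: s_def)
    have "D n z = min n s" for n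
    proof (induction n)
      case (Suc n)
      \<comment> \<open>Since \<open>pfst z \<le> s\<close>, the number \<open>z\<close> lies below
        \<open>triangle (Suc s)\<close>, so exactly the first \<open>s\<close> positive triangular
        numbers are counted.\<close>
      have "triangle (Suc n) \<le> z \<longleftrightarrow> Suc n \<le> s"
        using triangle_mono[of "Suc n" s] triangle_mono[of "Suc s" "Suc n"] z \<open>pfst z \<le> s\<close>
        by (cases "Suc n \<le> s") auto
      moreover have "D (Suc n) z = D n z + (1 - (triangle (Suc n) - z))"
        unfolding D_def by simp
      ultimately show ?case
        using Suc by auto
    qed (simp add: D_def)
    moreover have "s \<le> triangle s"
      by (induction s) auto
    ultimately show ?thesis
      using z unfolding s_def by (metis le_add1 le_trans min.absorb2)
  qed
  ultimately show ?thesis by simp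
qed

lemma pfst_eq: "pfst z = z - triangle (pfst z + psnd z)"
  using pair_pfst_psnd[of z] unfolding prod_encode_def by simp

lemma recursive_pfst [recursive_intros]: "recursive f \<Longrightarrow> recursive (\<lambda>x. pfst (f x))"
proof (rule recursive_compose[of pfst])
  have "recursive (\<lambda>z. z - triangle (pfst z + psnd z))"
    by (intro recursive_intros recursive_compose[OF recursive_triangle] recursive_pfst_plus_psnd)
  then show "recursive pfst"
    by (simp flip: pfst_eq)
qed

lemma recursive_psnd [recursive_intros]: "recursive f \<Longrightarrow> recursive (\<lambda>x. psnd (f x))"
proof (rule recursive_compose[of psnd])
  have "recursive (\<lambda>z. (pfst z + psnd z) - pfst z)"
    by (intro recursive2_compose[OF recursive2_diff] recursive_intros recursive_pfst_plus_psnd)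
  then show "recursive psnd"
    by simp
qed

lemma recursive2I: "recursive (\<lambda>z. F (pfst z) (psnd z)) \<Longrightarrow> recursive2 F"
  using recn_compose1[OF _ recn_pair[OF recn_nth recn_nth], of "\<lambda>z. F (pfst z) (psnd z)" 0 2 1]
  by (simp add: recursive2_recn)

text \<open>Parameter, counter and previous value are packed into one number, so that the premise
  again concerns a unary function and \<open>recursive_intros\<close> can take nested recursions
  apart syntactically. Bounded sums and quantifiers follow the same pattern.\<close>

lemma recursive_rec_nat_param [recursive_intros]:
  assumes "recursive a" "recursive (\<lambda>z. G (pfst z) (pfst (psnd z)) (psnd (psnd z)))" "recursive n"
  shows "recursive (\<lambda>x. rec_nat (a x) (\<lambda>i y. G x i y) (n x))"
proof -
  have "recn 3 (\<lambda>xs. G (xs ! 2) (xs ! 0) (xs ! 1))"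
    using recn_compose1[OF assms(2), of 3 "\<lambda>xs. pair (xs ! 2) (pair (xs ! 0) (xs ! 1))"]
    by (simp add: recn_pair recn_nth)
  then have "recursive2 (\<lambda>n x. rec_nat (a x) (\<lambda>i y. G x i y) n)"
    using recursive2_rec_nat[OF assms(1), where G = "\<lambda>i y x. G x i y"] by simp
  from recursive2_compose[OF this assms(3) recursive_id] show ?thesis .
qed

lemma recursive_sum [recursive_intros]:
  assumes "recursive (\<lambda>z. G (pfst z) (psnd z))" "recursive n"
  shows "recursive (\<lambda>x. \<Sum>i<n x. G x i)"
proof -
  have *: "recursive (\<lambda>z. G (pfst z) (pfst (psnd z)))"
    using recursive_compose[OF assms(1), of "\<lambda>z. pair (pfst z) (pfst (psnd z))"]
    by (simp add: recursive_intros)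
  have "recursive (\<lambda>x. rec_nat 0 (\<lambda>i y. y + G x i) (n x))"
    by (intro recursive_intros * assms)
  moreover have "rec_nat 0 (\<lambda>i y. y + G x i) m = (\<Sum>i<m. G x i)" for x m
    by (induction m) auto
  ultimately show ?thesis by simp
qed

section \<open>Decidable predicates and further arithmetic functions\<close>

definition decidable :: "(nat \<Rightarrow> bool) \<Rightarrow> bool" where
  "decidable P \<longleftrightarrow> recursive (\<lambda>x. of_bool (P x))"

lemma decidable_eqI: "decidable P \<Longrightarrow> (\<And>x. P x = Q x) \<Longrightarrow> decidable Q"
  by (simp add: decidable_def)

lemma decidable_const [recursive_intros]: "decidable (\<lambda>x. b)"
  unfolding decidable_def by (rule recursive_const)

lemma recursive_of_bool [recursive_intros]: "decidable P \<Longrightarrow> recursive (\<lambda>x. of_bool (P x))"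
  by (simp add: decidable_def)

lemma recursive_if [recursive_intros]:
  assumes "decidable P" "recursive f" "recursive g"
  shows "recursive (\<lambda>x. if P x then f x else g x)"
proof -
  have "recursive (\<lambda>x. of_bool (P x) * f x + (1 - of_bool (P x)) * g x)"
    by (intro recursive_intros assms)
  moreover have "of_bool (P x) * f x + (1 - of_bool (P x)) * g x = (if P x then f x else g x)" for x
    by simp
  ultimately show ?thesis by (rule recursive_eqI)
qed

lemma decidable_not [recursive_intros]: "decidable P \<Longrightarrow> decidable (\<lambda>x. \<not> P x)"
proof -
  assume "decidable P"
  then have "recursive (\<lambda>x. 1 - of_bool (P x))" by (intro recursive_intros)
  moreover have "(1 - of_bool (P x)) = (of_bool (\<not> P x) :: nat)" for x by simp
  ultimately show ?thesis unfolding decidable_def by simp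
qed

lemma decidable_conj [recursive_intros]:
  "decidable P \<Longrightarrow> decidable Q \<Longrightarrow> decidable (\<lambda>x. P x \<and> Q x)"
  unfolding decidable_def of_bool_conj by (intro recursive2_compose[OF recursive2_mult])

lemma decidable_disj [recursive_intros]:
  assumes "decidable P" "decidable Q"
  shows "decidable (\<lambda>x. P x \<or> Q x)"
proof -
  have "decidable (\<lambda>x. \<not> (\<not> P x \<and> \<not> Q x))" by (intro recursive_intros assms)
  then show ?thesis by simp
qed

lemma decidable_imp [recursive_intros]:
  assumes "decidable P" "decidable Q"
  shows "decidable (\<lambda>x. P x \<longrightarrow> Q x)"
proof -
  have "decidable (\<lambda>x. \<not> P x \<or> Q x)" by (intro recursive_intros assms)
  then show ?thesis by (rule decidable_eqI) blast
qed

lemma decidable_if [recursive_intros]: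
  assumes "decidable P" "decidable Q" "decidable Q'"
  shows "decidable (\<lambda>x. if P x then Q x else Q' x)"
proof -
  have "decidable (\<lambda>x. (P x \<and> Q x) \<or> (\<not> P x \<and> Q' x))" by (intro recursive_intros assms)
  moreover have "(P x \<and> Q x) \<or> (\<not> P x \<and> Q' x) \<longleftrightarrow> (if P x then Q x else Q' x)" for x by simp
  ultimately show ?thesis by (rule decidable_eqI)
qed

lemma decidable_le [recursive_intros]:
  assumes "recursive f" "recursive g"
  shows "decidable (\<lambda>x. f x \<le> g x)"
proof -
  have "recursive (\<lambda>x. 1 - (f x - g x))" by (intro recursive_intros assms)
  moreover have "1 - (f x - g x) = of_bool (f x \<le> g x)" for x by auto
  ultimately show ?thesis unfolding decidable_def by (rule recursive_eqI)
qed

lemma decidable_less [recursive_intros]: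
  assumes "recursive f" "recursive g"
  shows "decidable (\<lambda>x. f x < g x)"
proof -
  have "decidable (\<lambda>x. Suc (f x) \<le> g x)" by (intro recursive_intros assms)
  then show ?thesis by (simp add: Suc_le_eq)
qed

lemma decidable_eq [recursive_intros]:
  assumes "recursive f" "recursive g"
  shows "decidable (\<lambda>x. f x = g x)"
proof -
  have "decidable (\<lambda>x. f x \<le> g x \<and> g x \<le> f x)" by (intro recursive_intros assms)
  moreover have "f x \<le> g x \<and> g x \<le> f x \<longleftrightarrow> f x = g x" for x by auto
  ultimately show ?thesis by (rule decidable_eqI)
qed

lemma decidable_all [recursive_intros]:
  assumes "decidable (\<lambda>z. P (pfst z) (psnd z))" "recursive n"
  shows "decidable (\<lambda>x. \<forall>i<n x. P x i)"
proof -
  have "decidable (\<lambda>x. (\<Sum>i<n x. of_bool (\<not> P x i)) = (0::nat))"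
    by (intro recursive_intros assms)
  then show ?thesis by (rule decidable_eqI) auto
qed

lemma decidable_ex [recursive_intros]:
  assumes "decidable (\<lambda>z. P (pfst z) (psnd z))" "recursive n"
  shows "decidable (\<lambda>x. \<exists>i<n x. P x i)"
proof -
  have "decidable (\<lambda>x. \<not> (\<forall>i<n x. \<not> P x i))" by (intro recursive_intros assms)
  then show ?thesis by simp
qed

lemma recursive_min [recursive_intros]:
  "recursive f \<Longrightarrow> recursive g \<Longrightarrow> recursive (\<lambda>x. min (f x) (g x))"
  unfolding min_def by (intro recursive_intros)

lemma recursive_max [recursive_intros]:
  "recursive f \<Longrightarrow> recursive g \<Longrightarrow> recursive (\<lambda>x. max (f x) (g x))"
  unfolding max_def by (intro recursive_intros)

lemma recursive_power [recursive_intros]: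
  assumes "recursive f" "recursive g"
  shows "recursive (\<lambda>x. f x ^ g x)"
proof -
  have f: "recursive (\<lambda>z. f (pfst z))"
    by (intro recursive_compose[OF assms(1)] recursive_intros)
  have "recursive (\<lambda>x. rec_nat 1 (\<lambda>i y. f x * y) (g x))"
    by (intro recursive_intros f assms)
  moreover have "rec_nat 1 (\<lambda>i y. a * y) n = a ^ n" for a n :: nat
    by (induction n) auto
  ultimately show ?thesis by (rule recursive_eqI)
qed

text \<open>The quotient counts the positive multiples of the divisor up to the dividend. For
  divisor 0 every multiple would count, so the value 0 is set separately.\<close>

lemma recursive_div [recursive_intros]:
  assumes "recursive f" "recursive g"
  shows "recursive (\<lambda>x. f x div g x)"
proof -
  have f: "recursive (\<lambda>z. f (pfst z))" and g: "recursive (\<lambda>z. g (pfst z))"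
    by (intro recursive_compose[OF assms(1)] recursive_compose[OF assms(2)] recursive_intros)+
  have "recursive (\<lambda>x. if g x = 0 then 0 else \<Sum>i<f x. of_bool (Suc i * g x \<le> f x))"
    by (intro recursive_intros f g assms)
  moreover have "(if b = 0 then 0 else \<Sum>i<a. of_bool (Suc i * b \<le> a)) = a div b" for a b :: nat
  proof (cases "b = 0")
    case False
    then have "{i. i < a \<and> Suc i * b \<le> a} = {..<a div b}"
      by (auto simp: less_eq_div_iff_mult_less_eq Suc_le_eq[symmetric] simp del: mult_Suc)
         (metis Suc_le_eq div_le_dividend le_trans less_eq_div_iff_mult_less_eq)
    with False show ?thesis
      by (simp add: lessThan_def Collect_conj_eq[symmetric] flip: sum.inter_filter)
  qed simp
  ultimately show ?thesis by (rule recursive_eqI)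
qed

lemma decidable_even [recursive_intros]: "recursive f \<Longrightarrow> decidable (\<lambda>x. even (f x))"
  unfolding even_iff_mod_2_eq_zero minus_div_mult_eq_mod[symmetric] by (intro recursive_intros)

section \<open>A decidable step-counting predicate for all recursive expressions\<close>

fun code :: "recf \<Rightarrow> nat" where
  "code Zero = pair 0 0"
| "code Succ = pair 1 0"
| "code (Proj i) = pair 2 i"
| "code (Comp f gs) = pair 3 (pair (code f) (list_encode (map code gs)))"
| "code (PrimRec f g) = pair 4 (pair (code f) (code g))"
| "code (Mu f) = pair 5 (code f)"

text \<open>These are the constructor and the selectors of \<open>list_encode\<close> on codes, in a
  form to which \<open>recursive_intros\<close> applies; 0 is the empty list.\<close>

definition ccons :: "nat \<Rightarrow> nat \<Rightarrow> nat" where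
  "ccons x l = Suc (pair x l)"

definition chd :: "nat \<Rightarrow> nat" where
  "chd l = pfst (l - 1)"

definition ctl :: "nat \<Rightarrow> nat" where
  "ctl l = psnd (l - 1)"

lemma ccons_simps [simp]: "chd (ccons x l) = x" "ctl (ccons x l) = l" "ccons x l \<noteq> 0"
  by (auto simp: ccons_def chd_def ctl_def)

lemma ccons_chd_ctl: "l \<noteq> 0 \<Longrightarrow> ccons (chd l) (ctl l) = l"
  by (simp add: ccons_def chd_def ctl_def)

lemma list_encode_Cons [simp]: "list_encode (x # xs) = ccons x (list_encode xs)"
  by (simp add: ccons_def)

declare list_encode.simps(2) [simp del]

lemma list_encode_eq_0_iff [simp]: "list_encode xs = 0 \<longleftrightarrow> xs = []"
  by (cases xs) (auto simp: ccons_def)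

text \<open>\<open>justified s M c l y\<close> says that the judgement "expression \<open>c\<close> has value \<open>y\<close> on the argument
  list \<open>l\<close>" follows by one inference from judgements in \<open>M\<close>, all intermediate values being
  below \<open>s\<close>. Tags 0 to 5 are those of \<^const>\<open>code\<close>. A code with tag 6 stands for a list of
  expressions, evaluated to the list of their values. A code with tag 7 has value \<open>y\<close> if the
  expression it contains takes positive values for all first arguments below \<open>y\<close>.
  With these two kinds of judgements every inference has at most two premises.\<close>

definition justified :: "nat \<Rightarrow> (nat \<Rightarrow> nat \<Rightarrow> nat \<Rightarrow> bool) \<Rightarrow> nat \<Rightarrow> nat \<Rightarrow> nat \<Rightarrow> bool" where
  "justified s M c l y \<longleftrightarrow>
    pfst c = 0 \<and> y = 0 \<or>
    pfst c = 1 \<and> l \<noteq> 0 \<and> ctl l = 0 \<and> y = Suc (chd l) \<or>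
    pfst c = 2 \<and> l \<noteq> 0 \<and> (if psnd c = 0 then y = chd l else M (pair 2 (psnd c - 1)) (ctl l) y) \<or>
    pfst c = 3 \<and> (\<exists>w<s. M (pair 6 (psnd (psnd c))) l w \<and> M (pfst (psnd c)) w y) \<or>
    pfst c = 4 \<and> l \<noteq> 0 \<and> (if chd l = 0 then M (pfst (psnd c)) (ctl l) y
      else \<exists>w<s. M c (ccons (chd l - 1) (ctl l)) w \<and>
        M (psnd (psnd c)) (ccons (chd l - 1) (ccons w (ctl l))) y) \<or>
    pfst c = 5 \<and> M (psnd c) (ccons y l) 0 \<and> M (pair 7 (psnd c)) l y \<or>
    pfst c = 6 \<and> (if psnd c = 0 then y = 0
      else y \<noteq> 0 \<and> M (chd (psnd c)) l (chd y) \<and> M (pair 6 (ctl (psnd c))) l (ctl y)) \<or>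
    pfst c = 7 \<and> (if y = 0 then True
      else M c l (y - 1) \<and> (\<exists>w<s. M (psnd c) (ccons (y - 1) l) (Suc w)))"

text \<open>A finite set of judgements is stored in the binary digits of one number
  \<open>E\<close>, as by \<open>set_encode\<close>, so that primitive recursion can carry it from
  stage to stage.\<close>

definition in_code :: "nat \<Rightarrow> nat \<Rightarrow> nat \<Rightarrow> nat \<Rightarrow> bool" where
  "in_code E c l y \<longleftrightarrow> odd (E div 2 ^ pair c (pair l y))"

text \<open>Bounding the index \<open>t\<close> keeps every stage finite. It excludes no judgement
  for good, because the bound grows with the stage.\<close>

definition stage :: "nat \<Rightarrow> nat" where
  "stage s = rec_nat 0 (\<lambda>i E. \<Sum>t<i. of_bool
     (justified i (in_code E) (pfst t) (pfst (psnd t)) (psnd (psnd t))) * 2 ^ t) s"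

definition derived :: "nat \<Rightarrow> nat \<Rightarrow> nat \<Rightarrow> nat \<Rightarrow> bool" where
  "derived s = in_code (stage s)"

lemma decidable_derived [recursive_intros]:
  assumes "recursive s" "recursive c" "recursive l" "recursive y"
  shows "decidable (\<lambda>x. derived (s x) (c x) (l x) (y x))"
proof -
  have "recursive stage"
    unfolding stage_def justified_def in_code_def ccons_def chd_def ctl_def
    by (intro recursive_intros)
  from recursive_compose[OF this assms(1)] show ?thesis
    unfolding derived_def in_code_def by (intro recursive_intros assms)
qed

lemma derived_0: "\<not> derived 0 c l y"
  by (simp add: derived_def stage_def in_code_def)

lemma derived_Suc:
  "derived (Suc s) c l y \<longleftrightarrow> pair c (pair l y) < s \<and> justified s (derived s) c l y"
proof -
  define A where "A = {t. t < s \<and> justified s (derived s) (pfst t) (pfst (psnd t)) (psnd (psnd t))}"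
  have "stage (Suc s) = (\<Sum>t<s. of_bool
     (justified s (derived s) (pfst t) (pfst (psnd t)) (psnd (psnd t))) * 2 ^ t)"
    unfolding derived_def stage_def by simp
  also have "\<dots> = set_encode A"
    unfolding set_encode_def A_def by (rule sum.mono_neutral_cong_right) auto
  finally have "derived (Suc s) c l y \<longleftrightarrow> pair c (pair l y) \<in> set_decode (set_encode A)"
    unfolding derived_def in_code_def set_decode_def by simp
  also have "set_decode (set_encode A) = A"
    by (rule set_encode_inverse) (simp add: A_def)
  finally show ?thesis
    by (simp add: A_def)
qed

text \<open>\<open>M\<close> occurs only positively, and \<open>s\<close> only as an upper bound for
  existential witnesses.\<close>

lemma justified_mono:
  assumes "justified s M c l y" "s \<le> s'" "\<And>c l y. M c l y \<Longrightarrow> M' c l y"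
  shows "justified s' M' c l y"
  using assms unfolding justified_def by (smt (verit) order_less_le_trans)

lemma derived_mono: "derived s c l y \<Longrightarrow> s \<le> s' \<Longrightarrow> derived s' c l y"
proof (induction s arbitrary: s' c l y)
  case (Suc s)
  then obtain s'' where s': "s' = Suc s''" "s \<le> s''"
    by (cases s') auto
  have "justified s (derived s) c l y" and lt: "pair c (pair l y) < s"
    using Suc.prems(1) by (auto simp: derived_Suc)
  then have "justified s'' (derived s'') c l y"
    using justified_mono[OF _ s'(2)] Suc.IH s'(2) by blast
  with lt s' show ?case
    by (simp add: derived_Suc)
qed (simp add: derived_0)

text \<open>As stages increase, this amounts to being derived at some stage. The form with
  \<open>eventually\<close> lets the premises of an inference and lower bounds on the stage be
  combined by \<open>eventually_elim\<close>.\<close>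

definition derivable :: "nat \<Rightarrow> nat \<Rightarrow> nat \<Rightarrow> bool" where
  "derivable c l y \<longleftrightarrow> (\<forall>\<^sub>F s in sequentially. derived s c l y)"

lemma derivable_iff: "derivable c l y \<longleftrightarrow> (\<exists>s. derived s c l y)"
  unfolding derivable_def eventually_sequentially by (meson derived_mono order_refl)

lemma derivableI:
  assumes "\<forall>\<^sub>F s in sequentially. justified s (derived s) c l y"
  shows "derivable c l y"
proof -
  have "\<forall>\<^sub>F s in sequentially. derived (Suc s) c l y"
    using assms eventually_gt_at_top[of "pair c (pair l y)"]
    by eventually_elim (simp add: derived_Suc)
  then show ?thesis
    unfolding derivable_def by (subst (asm) eventually_sequentially_Suc)
qed

lemma derivable_Proj:
  "i < length xs \<Longrightarrow> derivable (pair 2 i) (list_encode xs) (xs ! i)"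
proof (induction xs arbitrary: i)
  case (Cons x xs)
  show ?case
  proof (cases i)
    case 0
    then show ?thesis
      by (intro derivableI always_eventually) (simp add: justified_def)
  next
    case (Suc j)
    with Cons have "derivable (pair 2 j) (list_encode xs) (xs ! j)" by simp
    then show ?thesis
      unfolding derivable_def[of _ _ "xs ! j"]
      by (intro derivableI, eventually_elim) (simp add: justified_def Suc)
  qed
qed simp

lemma derivable_list:
  assumes "length ys = length gs" "\<And>i. i < length gs \<Longrightarrow> derivable (code (gs ! i)) l (ys ! i)"
  shows "derivable (pair 6 (list_encode (map code gs))) l (list_encode ys)"
  using assms
proof (induction ys gs rule: list_induct2)
  case Nil
  show ?case
    by (intro derivableI always_eventually) (simp add: justified_def)
next
  case (Cons y ys g gs)
  have "derivable (pair 6 (list_encode (map code gs))) l (list_encode ys)"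
    using Cons.prems[of "Suc _"] by (intro Cons.IH) simp
  moreover have "derivable (code g) l y"
    using Cons.prems[of 0] by simp
  ultimately show ?case
    unfolding derivable_def[of "code g"] derivable_def[of "pair 6 (list_encode (map code gs))"]
    by (intro derivableI, eventually_elim) (simp add: justified_def)
qed

lemma derivable_below:
  assumes "\<And>m. m < n \<Longrightarrow> \<exists>w. derivable f (ccons m l) (Suc w)"
  shows "derivable (pair 7 f) l n"
  using assms
proof (induction n)
  case 0
  show ?case
    by (intro derivableI always_eventually) (simp add: justified_def)
next
  case (Suc n)
  then obtain w where "derivable f (ccons n l) (Suc w)" by blast
  moreover have "derivable (pair 7 f) l n"
    using Suc by simp
  ultimately show ?case
    unfolding derivable_def[of f] derivable_def[of _ l n]
    using eventually_gt_at_top[of w]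
    by (intro derivableI, eventually_elim) (auto simp add: justified_def)
qed

lemma evaluates_imp_derivable: "evaluates r xs y \<Longrightarrow> derivable (code r) (list_encode xs) y"
proof (induction rule: evaluates.induct)
  case (zero xs)
  show ?case
    by (intro derivableI always_eventually) (simp add: justified_def)
next
  case (succ x)
  show ?case
    by (intro derivableI always_eventually) (simp add: justified_def)
next
  case (proj i xs)
  then show ?case by (simp add: derivable_Proj)
next
  case (comp ys gs xs f z)
  have "derivable (pair 6 (list_encode (map code gs))) (list_encode xs) (list_encode ys)"
    using comp by (intro derivable_list) auto
  then show ?case
    using comp.IH(2) eventually_gt_at_top[of "list_encode ys"]
    unfolding derivable_def[of "code f"] derivable_def[of "pair 6 _"]
    by (intro derivableI, eventually_elim) (auto simp add: justified_def)
next
  case (primrec_0 f xs y g)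
  from primrec_0.IH show ?case
    unfolding derivable_def[of "code f"]
    by (intro derivableI, eventually_elim) (auto simp add: justified_def)
next
  case (primrec_Suc f g n xs y z)
  from primrec_Suc.IH eventually_gt_at_top[of y] show ?case
    unfolding derivable_def[of "code g"] derivable_def[of _ _ y]
    by (intro derivableI, eventually_elim) (auto simp add: justified_def)
next
  case (mu f n xs)
  have "derivable (pair 7 (code f)) (list_encode xs) n"
    using mu.IH(2) by (intro derivable_below) auto
  then show ?case
    using mu.IH(1) unfolding derivable_def[of "pair 7 _"] derivable_def[of "code f"]
    by (intro derivableI, eventually_elim) (auto simp add: justified_def)
qed

text \<open>The three kinds of judgements are treated in one induction on the stage, because each
  kind occurs among the premises of another. Judgements about numbers that code nothing may be
  derived too, but they are never premises of the judgements considered here.\<close>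

lemma derived_sound:
  "derived s (code r) (list_encode xs) y \<Longrightarrow> evaluates r xs y"
  "derived s (pair 6 (list_encode (map code gs))) (list_encode xs) v \<Longrightarrow>
    \<exists>ys. v = list_encode ys \<and> length ys = length gs \<and> (\<forall>i<length gs. evaluates (gs ! i) xs (ys ! i))"
  "derived s (pair 7 (code f)) (list_encode xs) n \<Longrightarrow> \<forall>m<n. \<exists>w. evaluates f (m # xs) (Suc w)"
proof (induction s arbitrary: r xs y gs v f n)
  case (Suc s)
  {
    case 1
    then have J: "justified s (derived s) (code r) (list_encode xs) y"
      by (simp add: derived_Suc)
    show ?case
    proof (cases r)
      case Zero
      with J show ?thesis by (auto simp: justified_def intro: evaluates.zero)
    next
      case Succ
      with J show ?thesis
        by (cases xs) (auto simp: justified_def intro: evaluates.succ)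
    next
      case (Proj i)
      then obtain x xs' where xs: "xs = x # xs'"
        using J by (cases xs) (auto simp: justified_def)
      show ?thesis
      proof (cases i)
        case 0
        then show ?thesis
          using J Proj xs evaluates.proj[of 0 xs] by (simp add: justified_def)
      next
        case (Suc j)
        then have "derived s (code (recf.Proj j)) (list_encode xs') y"
          using J Proj xs by (simp add: justified_def)
        then have "evaluates (recf.Proj j) xs' y"
          by (rule Suc.IH)
        then have "j < length xs'" "y = xs' ! j"
          by (auto elim: evaluates.cases)
        then show ?thesis
          using evaluates.proj[of i xs] Proj Suc xs by simp
      qed
    next
      case (Comp f gs)
      then obtain w where w: "derived s (pair 6 (list_encode (map code gs))) (list_encode xs) w"
        "derived s (code f) w y"
        using J by (auto simp: justified_def)
      obtain ys where ys: "w = list_encode ys" "length ys = length gs"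
        "\<forall>i<length gs. evaluates (gs ! i) xs (ys ! i)"
        using Suc.IH(2)[OF w(1)] by blast
      with w(2) have "evaluates f ys y"
        by (intro Suc.IH(1)) simp
      with ys Comp show ?thesis
        by (auto intro: evaluates.comp)
    next
      case (PrimRec f g)
      then obtain x xs' where xs: "xs = x # xs'"
        using J by (cases xs) (auto simp: justified_def)
      show ?thesis
      proof (cases x)
        case 0
        then have "derived s (code f) (list_encode xs') y"
          using J PrimRec xs by (simp add: justified_def)
        then show ?thesis
          unfolding PrimRec xs 0 by (intro evaluates.primrec_0 Suc.IH(1))
      next
        case (Suc m)
        then obtain w where "derived s (code r) (list_encode (m # xs')) w"
          "derived s (code g) (list_encode (m # w # xs')) y"
          using J PrimRec xs by (auto simp: justified_def)
        then have "evaluates r (m # xs') w" "evaluates g (m # w # xs') y"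
          by (auto intro: Suc.IH(1) simp del: list_encode_Cons)
        then show ?thesis
          unfolding PrimRec xs Suc by (rule evaluates.primrec_Suc)
      qed
    next
      case (Mu f)
      then have *: "derived s (code f) (list_encode (y # xs)) 0"
        "derived s (pair 7 (code f)) (list_encode xs) y"
        using J by (auto simp: justified_def)
      show ?thesis
        unfolding Mu by (rule evaluates.mu[OF Suc.IH(1)[OF *(1)] Suc.IH(3)[OF *(2)]])
    qed
  next
    case 2
    then have J: "justified s (derived s) (pair 6 (list_encode (map code gs))) (list_encode xs) v"
      by (simp add: derived_Suc)
    show ?case
    proof (cases gs)
      case Nil
      with J show ?thesis by (auto simp: justified_def)
    next
      case (Cons g gs')
      with J have v: "v \<noteq> 0" "derived s (code g) (list_encode xs) (chd v)"
        "derived s (pair 6 (list_encode (map code gs'))) (list_encode xs) (ctl v)"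
        by (auto simp: justified_def)
      obtain ys where ys: "ctl v = list_encode ys" "length ys = length gs'"
        "\<forall>i<length gs'. evaluates (gs' ! i) xs (ys ! i)"
        using Suc.IH(2)[OF v(3)] by blast
      have "v = list_encode (chd v # ys)"
        using ccons_chd_ctl[OF v(1)] ys(1) by simp
      moreover have "evaluates ((g # gs') ! i) xs ((chd v # ys) ! i)" if "i < length (g # gs')" for i
        using that ys(3) Suc.IH(1)[OF v(2)] by (cases i) auto
      ultimately show ?thesis
        unfolding Cons using ys(2) by (metis length_Cons)
    qed
  next
    case 3
    then have J: "justified s (derived s) (pair 7 (code f)) (list_encode xs) n"
      by (simp add: derived_Suc)
    show ?case
    proof (cases n)
      case (Suc k)
      then obtain w where "derived s (pair 7 (code f)) (list_encode xs) k"
        "derived s (code f) (list_encode (k # xs)) (Suc w)"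
        using J by (auto simp: justified_def)
      then have "\<forall>m<k. \<exists>w. evaluates f (m # xs) (Suc w)" "evaluates f (k # xs) (Suc w)"
        using Suc.IH by (blast, blast)
      then show ?thesis
        using Suc by (auto simp: less_Suc_eq)
    qed simp
  }
qed (simp_all add: derived_0)

text \<open>This takes the place of Kleene's normal form theorem: \<open>derived\<close> is
  decidable uniformly in the code, so convergence can be watched stage by stage for all expressions
  at once.\<close>

theorem evaluates_iff_derived:
  "evaluates r xs y \<longleftrightarrow> (\<exists>s. derived s (code r) (list_encode xs) y)"
  using evaluates_imp_derivable derived_sound(1) unfolding derivable_iff by blast

section \<open>Left-r.e. numberings through recursive dyadic approximations\<close>

lemma len_0: "len 0 = 0"
  by (simp add: len_def)

text \<open>So \<open>len\<close> counts binary digits: \<open>x + 1\<close> ranges over the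
  interval from \<open>2 ^ n\<close> (excluded) to \<open>2 ^ Suc n\<close> (included), where the
  ceiling of the logarithm is constant.\<close>

lemma len_eq:
  assumes "2 ^ n \<le> x" "x < 2 ^ Suc n"
  shows "len x = Suc n"
proof -
  have "real (2 ^ n) < real (x + 1)" "real (x + 1) \<le> real (2 ^ Suc n)"
    using assms by (simp_all only: of_nat_less_iff of_nat_le_iff)
  then have "2 powr real n < real x + 1" "real x + 1 \<le> 2 powr real (Suc n)"
    by (simp_all add: powr_realpow powr_add)
  then have "real n < log 2 (real x + 1)" "log 2 (real x + 1) \<le> real (Suc n)"
    by (simp_all add: less_log_iff log_le_iff)
  then have "\<lceil>log 2 (real x + 1)\<rceil> = int (Suc n)"
    by (intro ceiling_unique) auto
  then show ?thesis
    unfolding len_def by simp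
qed

lemma dyadic_level:
  assumes "0 < x"
  obtains n where "2 ^ n \<le> x" "x < 2 ^ Suc n" "len x = Suc n"
  using ex_power_ivl1[of 2 x] assms len_eq by auto

text \<open>Ensures that the exponent \<open>s - len x\<close> used below for \<open>x < s\<close>
  is not truncated.\<close>

lemma len_le: "len x \<le> x"
proof (cases "x = 0")
  case False
  then obtain n where "2 ^ n \<le> x" "len x = Suc n"
    using dyadic_level by blast
  moreover have "n < 2 ^ n" by (rule less_exp)
  ultimately show ?thesis by linarith
qed (simp add: len_0)

lemma recursive_len [recursive_intros]: "recursive f \<Longrightarrow> recursive (\<lambda>x. len (f x))"
proof (rule recursive_compose[of len])
  have "recursive (\<lambda>x. \<Sum>i<x. of_bool (2 ^ i \<le> x))"
    by (intro recursive_intros)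
  then show "recursive len"
  proof (rule recursive_eqI)
    fix x :: nat
    show "(\<Sum>i<x. of_bool (2 ^ i \<le> x)) = len x"
    proof (cases "x = 0")
      case False
      then obtain n where n: "2 ^ n \<le> x" "x < 2 ^ Suc n" "len x = Suc n"
        using dyadic_level by blast
      have "i < x \<and> 2 ^ i \<le> x \<longleftrightarrow> i < Suc n" for i
      proof
        assume "i < x \<and> 2 ^ i \<le> x"
        then have "(2::nat) ^ i < 2 ^ Suc n" using n(2) by linarith
        then show "i < Suc n" by (simp only: power_strict_increasing_iff one_less_numeral_iff semiring_norm)
      next
        assume "i < Suc n"
        then have "(2::nat) ^ i \<le> 2 ^ n" by (intro power_increasing) auto
        with n(1) have "2 ^ i \<le> x" by linarith
        moreover have "i < 2 ^ i" by (rule less_exp)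
        ultimately show "i < x \<and> 2 ^ i \<le> x" by linarith
      qed
      then have "{..<x} \<inter> {i. 2 ^ i \<le> x} = {..<Suc n}"
        by auto
      then show ?thesis
        using n(3) by simp
    qed (simp add: len_0)
  qed
qed

text \<open>At stage \<open>s\<close> only arguments below \<open>s\<close> at which convergence to
  a value below \<open>s\<close> has been derived are counted. Their weights are multiples of
  \<open>1 / 2 ^ s\<close>, so the partial sum is given by a natural numerator.\<close>

lemma left_re_numbering_approx:
  assumes "left_re_numbering \<alpha>"
  shows "\<exists>a. recursive2 a \<and> (\<forall>i s. real (a i s) / 2 ^ s \<le> \<alpha> i) \<and>
    (\<forall>i. (\<lambda>s. real (a i s) / 2 ^ s) \<longlonglongrightarrow> \<alpha> i)"
proof -
  from assms obtain \<phi> where \<phi>: "numbering \<phi>"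
    "\<And>e. ((\<lambda>x. 1 / 2 ^ len x) has_sum \<alpha> e) (dom (\<phi> e))"
    unfolding left_re_numbering_def by blast
  then obtain r where "\<And>xs y. length xs = 2 \<Longrightarrow> \<phi> (xs ! 0) (xs ! 1) = Some y \<longleftrightarrow> evaluates r xs y"
    unfolding numbering_def partial_recursive_def by blast
  from this[of "[_, _]"] have r: "\<phi> e x = Some y \<longleftrightarrow> evaluates r [e, x] y" for e x y
    by simp
  define A where "A e x s \<longleftrightarrow> (\<exists>y<s. derived s (code r) (ccons e (ccons x 0)) y)" for e x s
  have A_mono: "A e x s'" if "A e x s" "s \<le> s'" for e x s s'
    using that derived_mono unfolding A_def by (meson order_less_le_trans)
  have A_dom: "x \<in> dom (\<phi> e) \<longleftrightarrow> (\<exists>s. A e x s)" for e x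
  proof
    assume "x \<in> dom (\<phi> e)"
    then obtain y s where "derived s (code r) (ccons e (ccons x 0)) y"
      using r evaluates_iff_derived[of r "[e, x]"] by auto
    then have "A e x (max s (Suc y))"
      unfolding A_def using derived_mono[OF _ max.cobounded1] by (intro exI[of _ y]) auto
    then show "\<exists>s. A e x s" ..
  next
    assume "\<exists>s. A e x s"
    then obtain y where "evaluates r [e, x] y"
      unfolding A_def evaluates_iff_derived by auto
    then show "x \<in> dom (\<phi> e)"
      using r by blast
  qed
  define F where "F i s = {x. x < s \<and> A i x s}" for i s
  define a where "a i s = (\<Sum>x<s. of_bool (A i x s) * 2 ^ (s - len x) :: nat)" for i s
  have a_eq: "real (a i s) / 2 ^ s = (\<Sum>x\<in>F i s. 1 / 2 ^ len x)" for i s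
  proof -
    have "real (a i s) = (\<Sum>x\<in>F i s. 2 ^ (s - len x))"
      unfolding a_def F_def of_nat_sum by (rule sum.mono_neutral_cong_right) auto
    also have "\<dots> = (\<Sum>x\<in>F i s. 2 ^ s / 2 ^ len x)"
      by (intro sum.cong refl power_diff) (auto simp: F_def intro: order_trans[OF len_le])
    finally show ?thesis
      by (simp add: sum_divide_distrib)
  qed
  have F: "finite (F i s)" "F i s \<subseteq> dom (\<phi> i)" for i s
    using A_dom unfolding F_def by (simp, blast)
  show ?thesis
  proof (intro exI[of _ a] conjI allI)
    show "recursive2 a"
      unfolding a_def A_def ccons_def by (intro recursive2I recursive_intros)
    show "real (a i s) / 2 ^ s \<le> \<alpha> i" for i s
      unfolding a_eq by (rule finite_sum_le_has_sum[OF \<phi>(2) F]) simp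
    show "(\<lambda>s. real (a i s) / 2 ^ s) \<longlonglongrightarrow> \<alpha> i" for i
    proof -
      \<comment> \<open>The sets \<open>F i s\<close> are cofinal among the finite subsets of the
        domain, so the limit that defines \<open>has_sum\<close> may be taken along them.\<close>
      have "\<forall>\<^sub>F s in sequentially. Y \<subseteq> F i s" if "finite Y" "Y \<subseteq> dom (\<phi> i)" for Y
      proof -
        have "\<forall>\<^sub>F s in sequentially. x \<in> F i s" if "x \<in> Y" for x
        proof -
          obtain s where s: "A i x s"
            using \<open>Y \<subseteq> dom (\<phi> i)\<close> \<open>x \<in> Y\<close> A_dom by blast
          show ?thesis
            using eventually_ge_at_top[of s] eventually_gt_at_top[of x]
            by eventually_elim (use A_mono[OF s] in \<open>auto simp: F_def\<close>)
        qed
        with \<open>finite Y\<close> have "\<forall>\<^sub>F s in sequentially. \<forall>x\<in>Y. x \<in> F i s"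
          by (simp add: eventually_ball_finite)
        then show ?thesis by eventually_elim blast
      qed
      then have "filterlim (F i) (finite_subsets_at_top (dom (\<phi> i))) sequentially"
        unfolding filterlim_finite_subsets_at_top using F by (auto elim: eventually_mono)
      from filterlim_compose[OF \<phi>(2)[unfolded has_sum_def] this] show ?thesis
        unfolding a_eq .
    qed
  qed
qed

text \<open>A search whose test ignores the search variable stops at 0 or never, so
  \<open>Mu\<close> turns a decision procedure for \<open>B\<close> into a partial function with
  domain \<open>B\<close>.\<close>

lemma decidable_domain:
  assumes "recursive (\<lambda>z. of_bool (B (pfst z) (psnd z)))"
  shows "\<exists>\<phi>. numbering \<phi> \<and> (\<forall>e. dom (\<phi> e) = {x. B e x})"
proof -
  have "recursive2 (\<lambda>e x. of_bool (\<not> B e x))"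
    using assms by (intro recursive2I recursive_intros) (simp add: decidable_def)
  then have "recn 3 (\<lambda>xs. of_bool (\<not> B (xs ! 1) (xs ! 2)))"
    by (rule recn_compose2) (auto intro: recn_nth)
  then obtain r where r: "\<And>xs. length xs = 3 \<Longrightarrow> evaluates r xs (of_bool (\<not> B (xs ! 1) (xs ! 2)))"
    unfolding recn_def by blast
  have r: "evaluates r [n, e, x] (of_bool (\<not> B e x))" for n e x
    using r[of "[n, e, x]"] by simp
  define \<phi> where "\<phi> e x = (if B e x then Some (0::nat) else None)" for e x
  have "\<phi> e x = Some y \<longleftrightarrow> evaluates (Mu r) [e, x] y" for e x y
  proof
    assume "\<phi> e x = Some y"
    then have "B e x" "y = 0" by (auto simp: \<phi>_def split: if_splits)
    then show "evaluates (Mu r) [e, x] y"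
      using r[of 0 e x] by (intro evaluates.mu) auto
  next
    assume "evaluates (Mu r) [e, x] y"
    then have 0: "evaluates r [y, e, x] 0" and lt: "\<forall>m<y. \<exists>z. evaluates r [m, e, x] (Suc z)"
      using evaluates_MuD by blast+
    have B: "B e x"
      using evaluates_deterministic[OF 0 r] by (simp split: if_splits)
    have "y = 0"
    proof (rule ccontr)
      assume "y \<noteq> 0"
      with lt obtain z where "evaluates r [0, e, x] (Suc z)" by blast
      from evaluates_deterministic[OF this r] B show False by simp
    qed
    with B show "\<phi> e x = Some y" by (simp add: \<phi>_def)
  qed
  then have "numbering \<phi>"
    unfolding numbering_def partial_recursive_def
    by (intro exI[of _ "Mu r"]) (auto simp: numeral_2_eq_2 length_Suc_conv)
  then show ?thesis
    by (intro exI[of _ \<phi>]) (auto simp: \<phi>_def dom_def split: if_splits)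
qed

text \<open>There are \<open>2 ^ n\<close> numbers of weight \<open>1 / 2 ^ Suc n\<close>, so the weight that a domain receives from
  the numbers of length \<open>Suc n\<close> is at most \<open>1 / 2\<close>; \<open>greedy k n / 2 ^ n\<close> is the total weight of those
  of length at most \<open>n\<close> when \<open>k n / 2 ^ n\<close> is approximated as fast as this allows.\<close>

definition greedy :: "(nat \<Rightarrow> nat) \<Rightarrow> nat \<Rightarrow> nat" where
  "greedy k n = rec_nat 0 (\<lambda>i K. max (2 * K) (min (k (Suc i)) (2 * K + 2 ^ i))) n"

lemma greedy_0 [simp]: "greedy k 0 = 0"
  and greedy_Suc: "greedy k (Suc n) = max (2 * greedy k n) (min (k (Suc n)) (2 * greedy k n + 2 ^ n))"
  by (simp_all add: greedy_def)

text \<open>The greedy sums increase and stay below \<open>\<beta>\<close>, hence converge to some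
  \<open>L\<close>. If \<open>L < \<beta>\<close>, then at a late stage both the target and the
  current sum plus \<open>1 / 2\<close> exceed \<open>L\<close>, and the next sum would too.\<close>

lemma greedy_tendsto:
  assumes le: "\<And>n. real (k n) / 2 ^ n \<le> \<beta>" and lim: "(\<lambda>n. real (k n) / 2 ^ n) \<longlonglongrightarrow> \<beta>"
  shows "(\<lambda>n. real (greedy k n) / 2 ^ n) \<longlonglongrightarrow> \<beta>"
proof -
  define S where "S n = real (greedy k n) / 2 ^ n" for n
  have S_Suc: "S (Suc n) = max (S n) (min (real (k (Suc n)) / 2 ^ Suc n) (S n + 1 / 2))" for n
  proof -
    have "S (Suc n) = max (2 * real (greedy k n)) (min (real (k (Suc n))) (2 * real (greedy k n) + 2 ^ n)) / 2 ^ Suc n"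
      unfolding S_def greedy_Suc by (simp add: of_nat_max of_nat_min)
    also have "\<dots> = max (2 * real (greedy k n) / 2 ^ Suc n)
        (min (real (k (Suc n)) / 2 ^ Suc n) ((2 * real (greedy k n) + 2 ^ n) / 2 ^ Suc n))"
      by (simp add: max_divide_distrib_right min_divide_distrib_right)
    also have "2 * real (greedy k n) / 2 ^ Suc n = S n"
      by (simp add: S_def)
    also have "(2 * real (greedy k n) + 2 ^ n) / 2 ^ Suc n = S n + 1 / 2"
      by (simp add: S_def add_divide_distrib)
    finally show ?thesis .
  qed
  have "0 \<le> \<beta>" using le[of 0] by (meson divide_nonneg_nonneg of_nat_0_le_iff order_trans zero_le_numeral zero_le_power)
  then have S_le: "S n \<le> \<beta>" for n
  proof (induction n)
    case (Suc n)
    then show ?case using le[of "Suc n"] unfolding S_Suc by (simp add: min_le_iff_disj)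
  qed (simp add: S_def)
  have inc: "incseq S"
    by (rule incseq_SucI) (simp add: S_Suc)
  then obtain L where L: "S \<longlonglongrightarrow> L" "\<And>n. S n \<le> L"
    using incseq_convergent[OF inc] S_le by blast
  have "L = \<beta>"
  proof (rule ccontr)
    assume "L \<noteq> \<beta>"
    moreover have "L \<le> \<beta>" using L(1) S_le by (intro LIMSEQ_le_const2) auto
    ultimately have "L < \<beta>" by simp
    then have "\<forall>\<^sub>F n in sequentially. L < real (k n) / 2 ^ n"
      using lim by (rule order_tendstoD(1)[rotated])
    moreover have "\<forall>\<^sub>F n in sequentially. L - 1 / 2 < S n"
      using L(1) by (rule order_tendstoD(1)) simp
    ultimately have "\<forall>\<^sub>F n in sequentially. L < real (k n) / 2 ^ n \<and> L - 1 / 2 < S n"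
      by eventually_elim simp
    then obtain N where N: "\<And>n. n \<ge> N \<Longrightarrow> L < real (k n) / 2 ^ n \<and> L - 1 / 2 < S n"
      by (auto simp: eventually_sequentially)
    have "L < S (Suc N)"
      unfolding S_Suc using N[of N] N[of "Suc N"] by (simp add: less_max_iff_disj)
    with L(2)[of "Suc N"] show False by simp
  qed
  with L(1) show ?thesis unfolding S_def by simp
qed

text \<open>Partial sums of nonnegative terms increase, so their limit is determined along the
  subsequence \<open>2 ^ n\<close>, that is, block by block of numbers of equal length.\<close>

lemma has_sum_nat_blocks:
  fixes g :: "nat \<Rightarrow> real"
  assumes nonneg: "\<And>x. 0 \<le> g x" and lim: "(\<lambda>n. \<Sum>x<2 ^ n. g x) \<longlonglongrightarrow> \<beta>"
  shows "(g has_sum \<beta>) UNIV"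
proof -
  have inc: "incseq (\<lambda>n. \<Sum>x<n. g x)"
    by (rule incseq_SucI) (simp add: nonneg)
  have bound: "(\<Sum>x<n. g x) \<le> \<beta>" for n
  proof -
    have "(\<Sum>x<n. g x) \<le> (\<Sum>x<2 ^ n. g x)"
      using inc by (rule incseqD) (simp add: less_imp_le)
    also have "\<dots> \<le> \<beta>"
    proof (rule incseq_le[OF _ lim])
      show "incseq (\<lambda>n. \<Sum>x<2 ^ n. g x)"
        using inc by (auto simp: mono_def intro: power_increasing)
    qed
    finally show ?thesis .
  qed
  obtain L where L: "(\<lambda>n. \<Sum>x<n. g x) \<longlonglongrightarrow> L"
    using incseq_convergent[OF inc] bound by blast
  have "strict_mono (\<lambda>n. 2 ^ n :: nat)"
    by (simp add: strict_mono_def)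
  from LIMSEQ_subseq_LIMSEQ[OF L this] lim have "L = \<beta>"
    by (intro LIMSEQ_unique) (auto simp: comp_def)
  with L have "g sums \<beta>"
    by (simp add: sums_def)
  then show ?thesis
    using nonneg by (intro sums_nonneg_imp_has_sum) auto
qed

text \<open>Converse to \<open>left_re_numbering_approx\<close>. From the block of numbers of length
  \<open>Suc n\<close> the domain receives the first \<open>c e n\<close>, whose weight is exactly
  the increment of the greedy sums.\<close>

lemma left_re_numberingI:
  assumes k: "recursive2 k" and le: "\<And>e n. real (k e n) / 2 ^ n \<le> \<beta> e"
    and lim: "\<And>e. (\<lambda>n. real (k e n) / 2 ^ n) \<longlonglongrightarrow> \<beta> e" and \<beta>: "\<And>e. \<beta> e \<in> {0..1}"
  shows "left_re_numbering \<beta>"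
proof -
  define c where "c e n = greedy (k e) (Suc n) - 2 * greedy (k e) n" for e n
  define B where "B e x \<longleftrightarrow> (\<exists>n<x. 2 ^ n \<le> x \<and> x < 2 ^ Suc n \<and> x - 2 ^ n < c e n)" for e x
  have rec_greedy: "recursive (\<lambda>x. greedy (k (f x)) (g x))" if "recursive f" "recursive g" for f g
    unfolding greedy_def
    by (intro recursive_intros recursive2_compose[OF k] that recursive_compose[OF that(1)])
  have "recursive (\<lambda>z. of_bool (B (pfst z) (psnd z)))"
    unfolding B_def c_def by (intro recursive_intros rec_greedy)
  then obtain \<phi> where \<phi>: "numbering \<phi>" "\<And>e. dom (\<phi> e) = {x. B e x}"
    using decidable_domain by blast
  have B_level: "B e (2 ^ n + j) \<longleftrightarrow> j < c e n" if "j < 2 ^ n" for e n j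
  proof
    assume "B e (2 ^ n + j)"
    then obtain m where m: "2 ^ m \<le> 2 ^ n + j" "2 ^ n + j < 2 ^ Suc m" "2 ^ n + j - 2 ^ m < c e m"
      unfolding B_def by blast
    have "Suc m = Suc n"
      using len_eq[OF m(1,2)] len_eq[of n "2 ^ n + j"] that by simp
    with m(3) show "j < c e n" by simp
  next
    assume "j < c e n"
    moreover have "n < 2 ^ n + j" using less_exp[of n] by linarith
    ultimately show "B e (2 ^ n + j)"
      unfolding B_def using that by (intro exI[of _ n]) auto
  qed
  have len_level: "len (2 ^ n + j) = Suc n" if "j < 2 ^ n" for n j :: nat
    using that by (intro len_eq) auto
  have "((\<lambda>x. 1 / 2 ^ len x) has_sum \<beta> e) (dom (\<phi> e))" for e
  proof -
    define g where "g x = (if B e x then 1 / 2 ^ len x else 0 :: real)" for x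
    have "(\<Sum>x<2 ^ n. g x) = real (greedy (k e) n) / 2 ^ n" for n
    proof (induction n)
      case 0
      have "\<not> B e 0" by (simp add: B_def)
      then show ?case by (simp add: g_def)
    next
      case (Suc n)
      have "c e n \<le> 2 ^ n"
        unfolding c_def greedy_Suc by simp
      have "{..<2 ^ Suc n} = {..<2 ^ n} \<union> {2 ^ n..<2 ^ n + (2::nat) ^ n}"
        by auto
      then have "(\<Sum>x<2 ^ Suc n. g x) = (\<Sum>x<2 ^ n. g x) + (\<Sum>x\<in>{2 ^ n..<2 ^ n + 2 ^ n}. g x)"
        by (simp add: sum.union_disjoint ivl_disj_int)
      also have "(\<Sum>x\<in>{2 ^ n..<2 ^ n + 2 ^ n}. g x) = (\<Sum>j<2 ^ n. g (2 ^ n + j))"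
        using sum.shift_bounds_nat_ivl[of g 0 "2 ^ n" "2 ^ n"]
        by (simp add: lessThan_atLeast0 add.commute)
      also have "\<dots> = (\<Sum>j<2 ^ n. if j < c e n then 1 / 2 ^ Suc n else 0)"
        by (intro sum.cong refl) (simp add: g_def B_level len_level)
      also have "\<dots> = (\<Sum>j<c e n. 1 / 2 ^ Suc n)"
        using \<open>c e n \<le> 2 ^ n\<close> by (intro sum.mono_neutral_cong_right) auto
      also have "\<dots> = real (c e n) / 2 ^ Suc n"
        by simp
      \<comment> \<open>The subtraction in \<open>c\<close> is exact, because \<open>greedy\<close>
        at least doubles at each step.\<close>
      also have "real (c e n) = real (greedy (k e) (Suc n)) - 2 * real (greedy (k e) n)"
        unfolding c_def greedy_Suc by simp
      finally show ?case
        using Suc.IH by (simp add: field_simps)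
    qed
    then have "(\<lambda>n. \<Sum>x<2 ^ n. g x) \<longlonglongrightarrow> \<beta> e"
      using greedy_tendsto[OF le lim] by simp
    then have "(g has_sum \<beta> e) UNIV"
      by (intro has_sum_nat_blocks) (auto simp: g_def)
    then show ?thesis
      unfolding \<phi> by (rule has_sum_cong_neutral[THEN iffD1, rotated -1]) (auto simp: g_def)
  qed
  with \<phi>(1) \<beta> show ?thesis
    unfolding left_re_numbering_def by blast
qed

text \<open>Even codes stand for nonnegative integers and odd ones for negative integers. Equal
  parity of numerator and denominator thus reduces the floor to natural division; otherwise the
  quotient is at most 0 and \<open>nat\<close> returns 0.\<close>

lemma recursive_nat_floor_rat:
  assumes "recursive f"
  shows "recursive (\<lambda>n. nat \<lfloor>2 ^ n * real_of_rat (nat_to_rat_surj (f n))\<rfloor>)"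
proof -
  define mag where "mag a = (if even a then a div 2 else Suc (a div 2))" for a :: nat
  have mag: "int_decode a = (if even a then int (mag a) else - int (mag a))" for a
    by (simp add: int_decode_def sum_decode_def mag_def)
  have "recursive (\<lambda>n. if even (pfst (f n)) \<and> even (psnd (f n)) \<or> odd (pfst (f n)) \<and> odd (psnd (f n))
      then (2 ^ n * mag (pfst (f n))) div mag (psnd (f n)) else 0)"
    unfolding mag_def by (intro recursive_intros assms)
  then show ?thesis
  proof (rule recursive_eqI)
    fix n
    define a b where "a = pfst (f n)" and "b = psnd (f n)"
    have "nat_to_rat_surj (f n) = Fract (int_decode a) (int_decode b)"
      by (simp add: nat_to_rat_surj_def a_def b_def pfst_def psnd_def split: prod.split)
    \<comment> \<open>A zero denominator is no exception, as both sides are then 0.\<close>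
    then have q: "real_of_rat (nat_to_rat_surj (f n)) = real_of_int (int_decode a) / real_of_int (int_decode b)"
      by (cases "int_decode b = 0") (simp_all add: of_rat_rat rat_number_collapse)
    show "(if even (pfst (f n)) \<and> even (psnd (f n)) \<or> odd (pfst (f n)) \<and> odd (psnd (f n))
      then (2 ^ n * mag (pfst (f n))) div mag (psnd (f n)) else 0) =
      nat \<lfloor>2 ^ n * real_of_rat (nat_to_rat_surj (f n))\<rfloor>"
    proof (cases "even a \<longleftrightarrow> even b")
      case True
      then have "2 ^ n * real_of_rat (nat_to_rat_surj (f n)) = real (2 ^ n * mag a) / real (mag b)"
        unfolding q mag by auto
      then have "\<lfloor>2 ^ n * real_of_rat (nat_to_rat_surj (f n))\<rfloor> = int ((2 ^ n * mag a) div mag b)"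
        by (simp only: floor_divide_of_nat_eq)
      with True show ?thesis
        unfolding a_def b_def by auto
    next
      case False
      then have "2 ^ n * real_of_rat (nat_to_rat_surj (f n)) \<le> 0"
        unfolding q mag by (auto simp: mult_nonneg_nonpos)
      then have "\<lfloor>2 ^ n * real_of_rat (nat_to_rat_surj (f n))\<rfloor> \<le> 0"
        by linarith
      with False show ?thesis
        unfolding a_def b_def by auto
    qed
  qed
qed

text \<open>Rounding down to \<open>n\<close> binary places costs at most \<open>1 / 2 ^ n\<close>,
  which vanishes in the limit. Negative terms become 0, which is still at most
  \<open>R\<close>.\<close>

lemma left_re_approx:
  assumes "left_re R"
  shows "\<exists>k. recursive k \<and> (\<forall>n. real (k n) / 2 ^ n \<le> R) \<and> (\<lambda>n. real (k n) / 2 ^ n) \<longlonglongrightarrow> R"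
proof -
  from assms obtain q f where q: "recursive f" "\<And>n. q n = nat_to_rat_surj (f n)" "mono q"
    "(\<lambda>n. real_of_rat (q n)) \<longlonglongrightarrow> R" and R: "0 \<le> R"
    unfolding left_re_def recursive_rat_seq_def by (metis atLeastAtMost_iff)
  define k where "k n = nat \<lfloor>2 ^ n * real_of_rat (q n)\<rfloor>" for n
  have "real_of_rat (q n) \<le> R" for n
    using q(3,4) by (intro incseq_le) (auto simp: mono_def of_rat_less_eq)
  then have "real (k n) \<le> 2 ^ n * R" for n
  proof -
    have "of_int \<lfloor>2 ^ n * real_of_rat (q n)\<rfloor> \<le> 2 ^ n * R"
      using \<open>real_of_rat (q n) \<le> R\<close> by (meson mult_left_mono of_int_floor_le order_trans zero_le_numeral zero_le_power)
    with R show ?thesis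
      unfolding k_def by (cases "0 \<le> \<lfloor>2 ^ n * real_of_rat (q n)\<rfloor>") simp_all
  qed
  then have le: "real (k n) / 2 ^ n \<le> R" for n
    by (simp add: divide_le_eq mult.commute)
  have ge: "real_of_rat (q n) - 1 / 2 ^ n \<le> real (k n) / 2 ^ n" for n
  proof -
    have "2 ^ n * real_of_rat (q n) - 1 \<le> real (k n)"
      unfolding k_def by linarith
    then have "(2 ^ n * real_of_rat (q n) - 1) / 2 ^ n \<le> real (k n) / 2 ^ n"
      by (rule divide_right_mono) simp
    then show ?thesis
      by (simp add: diff_divide_distrib)
  qed
  have "(\<lambda>n. real_of_rat (q n) - 1 / 2 ^ n) \<longlonglongrightarrow> R - 0"
    using q(4) by (intro tendsto_diff LIMSEQ_divide_realpow_zero) auto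
  then have lower: "(\<lambda>n. real_of_rat (q n) - 1 / 2 ^ n) \<longlonglongrightarrow> R" by simp
  have "(\<lambda>n. real (k n) / 2 ^ n) \<longlonglongrightarrow> R"
    by (rule tendsto_sandwich[OF _ _ lower tendsto_const]) (simp_all add: le ge)
  moreover have "recursive k"
    unfolding k_def q(2) by (rule recursive_nat_floor_rat[OF q(1)])
  ultimately show ?thesis
    using le by blast
qed

section \<open>Prefixing a real by a finite string\<close>

lemma bin_real_Cons: "bin_real ((b # \<sigma>) \<frown> X) = (of_bool b + bin_real (\<sigma> \<frown> X)) / 2"
proof -
  define f where "f n = of_bool (((b # \<sigma>) \<frown> X) n) / (2::real) ^ Suc n" for n
  have "summable (\<lambda>n. (1 / 2 :: real) ^ Suc n)"
    by (simp add: summable_geometric)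
  then have summable: "summable (\<lambda>n. of_bool (Y n) / (2::real) ^ Suc n)" for Y
    by (rule summable_comparison_test'[where N = 0]) (auto simp: power_divide)
  have "(\<Sum>n. f (Suc n)) = (\<Sum>n. (of_bool ((\<sigma> \<frown> X) n) / 2 ^ Suc n) / 2)"
    by (intro arg_cong[where f = suminf]) (auto simp: f_def conc_def)
  also have "\<dots> = bin_real (\<sigma> \<frown> X) / 2"
    unfolding bin_real_def by (rule suminf_divide[OF summable])
  finally have "bin_real (\<sigma> \<frown> X) / 2 = suminf f - f 0"
    using suminf_split_head[of f] summable unfolding f_def by simp
  moreover have "f 0 = of_bool b / 2"
    by (simp add: f_def conc_def)
  ultimately show ?thesis
    unfolding bin_real_def[of "(b # \<sigma>) \<frown> X"] f_def by (simp add: field_simps)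
qed

text \<open>The string is \<open>j\<close> written with \<open>n\<close> binary digits; the
  induction splits off the leading one.\<close>

lemma bin_real_prefix: "j < 2 ^ n \<Longrightarrow> \<exists>\<sigma>. bin_real (\<sigma> \<frown> X) = (real j + bin_real X) / 2 ^ n"
proof (induction n arbitrary: j)
  case 0
  then show ?case by (intro exI[of _ "[]"]) simp
next
  case (Suc n)
  define j' where "j' = (if j < 2 ^ n then j else j - 2 ^ n)"
  have "j' < 2 ^ n" using Suc.prems by (auto simp: j'_def)
  then obtain \<sigma> where \<sigma>: "bin_real (\<sigma> \<frown> X) = (real j' + bin_real X) / 2 ^ n"
    using Suc.IH by blast
  have "real j = of_bool (2 ^ n \<le> j) * 2 ^ n + real j'"
    by (auto simp: j'_def of_nat_diff)
  then show ?case
    by (intro exI[of _ "(2 ^ n \<le> j) # \<sigma>"]) (simp only: bin_real_Cons \<sigma>, simp add: field_simps)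
qed

section \<open>The diagonal construction\<close>

lemma rec_nat_max_ge: "n \<le> m \<Longrightarrow> t n \<le> rec_nat (t 0) (\<lambda>i y. max y (t (Suc i))) (m::nat)"
  for t :: "nat \<Rightarrow> 'a::linorder"
  by (induction m) (auto simp: le_Suc_eq le_max_iff_disj)

lemma rec_nat_max_attained: "\<exists>n\<le>m. rec_nat (t 0) (\<lambda>i y. max y (t (Suc i))) (m::nat) = t n"
  for t :: "nat \<Rightarrow> 'a::linorder"
proof (induction m)
  case (Suc m)
  then obtain n where "n \<le> m" "rec_nat (t 0) (\<lambda>i y. max y (t (Suc i))) m = t n" by blast
  then show ?case
    by (cases "t n \<le> t (Suc m)") (auto simp: max_def intro: exI[of _ "Suc m"] exI[of _ n])
qed simp

lemma bounded_mono_eventually_const: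
  fixes p :: "nat \<Rightarrow> nat"
  assumes "mono p" "\<And>s. p s \<le> N"
  obtains P where "\<forall>\<^sub>F s in sequentially. p s = P" "\<And>s. p s \<le> P"
proof -
  define P where "P = Max (range p)"
  have fin: "finite (range p)"
    by (rule finite_subset[of _ "{..N}"]) (use assms(2) in auto)
  have "P \<in> range p" unfolding P_def using fin by (intro Max_in) auto
  then obtain s0 where "p s0 = P" by auto
  have le: "p s \<le> P" for s
    unfolding P_def using fin by (intro Max_ge) auto
  have "\<forall>\<^sub>F s in sequentially. p s = P"
    using eventually_ge_at_top[of s0]
    by eventually_elim (use \<open>p s0 = P\<close> le assms(1) in \<open>metis antisym monoD\<close>)
  with le that show ?thesis by blast
qed

proposition diagonal_numbering:
  fixes \<alpha> \<tau> :: "nat \<Rightarrow> real" and t :: "nat \<Rightarrow> nat \<Rightarrow> nat"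
  assumes \<alpha>: "left_re_numbering \<alpha>" and R: "R \<notin> range \<alpha>"
    and t: "recursive2 t" and t_le: "\<And>n s. real (t n s) / 2 ^ s \<le> \<tau> n"
    and t_lim: "\<And>n. (\<lambda>s. real (t n s) / 2 ^ s) \<longlonglongrightarrow> \<tau> n"
    and \<tau>: "\<And>n. \<tau> n \<le> R" "\<tau> \<longlonglongrightarrow> R" "\<And>n. \<tau> n \<in> {0..1}"
  shows "\<exists>\<beta>. left_re_numbering \<beta> \<and> range \<beta> \<subseteq> range \<tau> \<and>
    \<not> (\<exists>f. recursive f \<and> (\<forall>e. \<alpha> (f e) = \<beta> e))"
proof -
  obtain a where a: "recursive2 a" "\<And>i s. real (a i s) / 2 ^ s \<le> \<alpha> i"
    "\<And>i. (\<lambda>s. real (a i s) / 2 ^ s) \<longlonglongrightarrow> \<alpha> i"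
    using left_re_numbering_approx[OF \<alpha>] by blast
  define best where "best s m = rec_nat (t 0 s) (\<lambda>i y. max y (t (Suc i) s)) m" for s m
  \<comment> \<open>The expression with code \<open>e\<close> is run on the list \<open>[e]\<close>,
    coded \<open>ccons e 0\<close>. All outputs \<open>i\<close> seen so far are tested, since
    uniqueness is known only when \<open>e\<close> really codes an expression. The two inequalities
    say that the approximations differ by less than \<open>1 / 2 ^ p\<close>, cleared of
    denominators and subtraction.\<close>
  define follows where "follows e s p \<longleftrightarrow> (\<exists>i<s. derived s e (ccons e 0) i) \<and>
      (\<forall>i<s. derived s e (ccons e 0) i \<longrightarrow>
        a i s * 2 ^ p < best s p * 2 ^ p + 2 ^ s \<and> best s p * 2 ^ p < a i s * 2 ^ p + 2 ^ s)" for e s p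
  define p where "p e s = rec_nat 0 (\<lambda>s p. if follows e s p then Suc p else p) s" for e s
  define b where "b e s = best s (p e s)" for e s
  have p_0: "p e 0 = 0" and p_Suc: "p e (Suc s) = (if follows e s (p e s) then Suc (p e s) else p e s)" for e s
    by (simp_all add: p_def)
  have p_mono: "mono (p e)" for e
    by (rule incseq_SucI) (simp add: p_Suc)
  have rec_best: "recursive (\<lambda>x. best (f x) (g x))" if "recursive f" "recursive g" for f g
    unfolding best_def
    by (intro recursive_intros recursive2_compose[OF t] that recursive_compose[OF that(1)])
  have rec_p: "recursive (\<lambda>x. p (f x) (g x))" if "recursive f" "recursive g" for f g
    unfolding p_def follows_def ccons_def
    by (intro recursive_intros recursive2_compose[OF a(1)] rec_best that recursive_compose[OF that(1)])
  have rec_b: "recursive2 b"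
    unfolding b_def by (intro recursive2I rec_best rec_p recursive_intros)
  have b_ge: "real (t n s) / 2 ^ s \<le> real (b e s) / 2 ^ s" if "n \<le> p e s" for n e s
    using rec_nat_max_ge[of n "p e s" "\<lambda>n. t n s"] that
    unfolding b_def best_def by (intro divide_right_mono) simp_all
  have b_attained: "\<exists>n\<le>p e s. b e s = t n s" for e s
    using rec_nat_max_attained[of "p e s" "\<lambda>n. t n s"] unfolding b_def best_def .
  have follows_iff: "follows e s (p e s) \<longleftrightarrow> (\<exists>i<s. derived s e (ccons e 0) i) \<and>
      (\<forall>i<s. derived s e (ccons e 0) i \<longrightarrow>
        \<bar>real (a i s) / 2 ^ s - real (b e s) / 2 ^ s\<bar> < 1 / 2 ^ p e s)" for e s
  proof -
    have "(u * 2 ^ q < v * 2 ^ q + 2 ^ s \<and> v * 2 ^ q < u * 2 ^ q + 2 ^ s) \<longleftrightarrow>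
        \<bar>real u / 2 ^ s - real v / 2 ^ s\<bar> < 1 / 2 ^ q" for u v q
    proof -
      have "\<bar>real u / 2 ^ s - real v / 2 ^ s\<bar> < 1 / 2 ^ q \<longleftrightarrow> \<bar>real u - real v\<bar> * 2 ^ q < 2 ^ s"
        by (simp add: field_simps flip: diff_divide_distrib)
      also have "\<bar>real u - real v\<bar> * 2 ^ q = \<bar>real u * 2 ^ q - real v * 2 ^ q\<bar>"
        by (simp add: abs_mult flip: left_diff_distrib)
      also have "\<dots> < 2 ^ s \<longleftrightarrow>
          real u * 2 ^ q < real v * 2 ^ q + 2 ^ s \<and> real v * 2 ^ q < real u * 2 ^ q + 2 ^ s"
        by linarith
      also have "\<dots> \<longleftrightarrow> real (u * 2 ^ q) < real (v * 2 ^ q + 2 ^ s) \<and> real (v * 2 ^ q) < real (u * 2 ^ q + 2 ^ s)"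
        by simp
      finally show ?thesis
        by (simp only: of_nat_less_iff)
    qed
    then show ?thesis
      unfolding follows_def b_def by simp
  qed
  have bounded: "\<exists>N. \<forall>s. p e s \<le> N" for e
  proof (rule ccontr)
    assume "\<not> (\<exists>N. \<forall>s. p e s \<le> N)"
    then have unbounded: "\<exists>s. N < p e s" for N
      by (meson not_le_imp_less)
    have p_large: "\<forall>\<^sub>F s in sequentially. N \<le> p e s" for N
    proof -
      obtain s0 where "N < p e s0" using unbounded by blast
      show ?thesis
        using eventually_ge_at_top[of s0]
        by eventually_elim (use \<open>N < p e s0\<close> p_mono[of e] in \<open>metis monoD less_imp_le order_trans\<close>)
    qed
    have b_lim: "(\<lambda>s. real (b e s) / 2 ^ s) \<longlonglongrightarrow> R"
    proof (rule order_tendstoI)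
      fix x assume "x < R"
      with \<tau>(2) have "\<forall>\<^sub>F n in sequentially. x < \<tau> n"
        by (rule order_tendstoD(1))
      then obtain n where "x < \<tau> n"
        by (auto simp: eventually_sequentially)
      with t_lim[of n] have "\<forall>\<^sub>F s in sequentially. x < real (t n s) / 2 ^ s"
        by (rule order_tendstoD(1))
      then show "\<forall>\<^sub>F s in sequentially. x < real (b e s) / 2 ^ s"
        using p_large[of n] by eventually_elim (use b_ge in \<open>metis order_less_le_trans\<close>)
    next
      fix x assume "R < x"
      have "real (b e s) / 2 ^ s \<le> R" for s
        using b_attained[of e s] t_le[of _ s] \<tau>(1) by (metis order_trans)
      with \<open>R < x\<close> show "\<forall>\<^sub>F s in sequentially. real (b e s) / 2 ^ s < x"
        by (intro always_eventually allI) (metis order_le_less_trans)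
    qed
    have step: "\<exists>s\<ge>s0. follows e s (p e s)" for s0
    proof (rule ccontr)
      assume "\<not> (\<exists>s\<ge>s0. follows e s (p e s))"
      then have "p e (Suc (s0 + d)) = p e (s0 + d)" for d
        by (simp add: p_Suc)
      then have "p e (s0 + d) = p e s0" for d
        by (induction d) simp_all
      moreover obtain s where "p e s0 < p e s" using unbounded by blast
      moreover from this have "s0 \<le> s" using p_mono[of e] by (meson monoD not_le_imp_less less_imp_le leD)
      ultimately show False by (metis le_add_diff_inverse less_irrefl)
    qed
    obtain s0 i where i: "derived s0 e (ccons e 0) i"
      using step[of 0] unfolding follows_iff by blast
    have "\<alpha> i = R"
    proof (rule ccontr)
      assume "\<alpha> i \<noteq> R"
      \<comment> \<open>The two approximations are \<open>\<delta>\<close> apart in the limit. Once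
        the tolerance is below \<open>\<delta> / 2\<close>, the test fails at all late stages, so no
        further phase could end.\<close>
      define \<delta> where "\<delta> = \<bar>\<alpha> i - R\<bar>"
      have "\<delta> > 0" using \<open>\<alpha> i \<noteq> R\<close> by (simp add: \<delta>_def)
      then obtain N where N: "(1 / 2) ^ N < \<delta> / 2"
        using real_arch_pow_inv[of "\<delta> / 2" "1 / 2"] by auto
      have "(\<lambda>s. \<bar>real (a i s) / 2 ^ s - real (b e s) / 2 ^ s\<bar>) \<longlonglongrightarrow> \<delta>"
        unfolding \<delta>_def by (rule tendsto_rabs[OF tendsto_diff[OF a(3) b_lim]])
      then have "\<forall>\<^sub>F s in sequentially. \<delta> / 2 < \<bar>real (a i s) / 2 ^ s - real (b e s) / 2 ^ s\<bar>"
        using \<open>\<delta> > 0\<close> by (intro order_tendstoD(1)) auto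
      then have "\<forall>\<^sub>F s in sequentially. \<not> follows e s (p e s)"
        using p_large[of N] eventually_ge_at_top[of s0] eventually_gt_at_top[of i]
      proof eventually_elim
        case (elim s)
        have "derived s e (ccons e 0) i"
          using derived_mono[OF i] elim by blast
        moreover have "(1::real) / 2 ^ p e s \<le> 1 / 2 ^ N"
          using elim by (intro divide_left_mono power_increasing) auto
        ultimately show ?case
          unfolding follows_iff using elim N by (force simp: power_divide)
      qed
      then show False
        using step by (auto simp: eventually_sequentially)
    qed
    with R show False by blast
  qed
  have "\<exists>v. v \<in> range \<tau> \<and> (\<forall>s. real (b e s) / 2 ^ s \<le> v) \<and> (\<lambda>s. real (b e s) / 2 ^ s) \<longlonglongrightarrow> v" for e
  proof -
    obtain P where P: "\<forall>\<^sub>F s in sequentially. p e s = P" "\<And>s. p e s \<le> P"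
      using bounded[of e] bounded_mono_eventually_const[OF p_mono] by metis
    define v where "v = Max (\<tau> ` {..P})"
    have "v \<in> \<tau> ` {..P}"
      unfolding v_def by (intro Max_in) auto
    then obtain n where n: "n \<le> P" "v = \<tau> n" by auto
    have le: "real (b e s) / 2 ^ s \<le> v" for s
    proof -
      obtain m where m: "m \<le> p e s" "b e s = t m s" using b_attained by blast
      then have "\<tau> m \<le> v"
        unfolding v_def using P(2)[of s] by (intro Max_ge) auto
      with t_le[of m s] m(2) show ?thesis by simp
    qed
    \<comment> \<open>Once the last phase \<open>P\<close> is reached, \<open>b e s\<close> is
      squeezed between the approximations of the maximal \<open>\<tau> n\<close> and
      \<open>v\<close> itself.\<close>
    have "\<forall>\<^sub>F s in sequentially. real (t n s) / 2 ^ s \<le> real (b e s) / 2 ^ s"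
      using P(1) by eventually_elim (use n b_ge in simp)
    then have "(\<lambda>s. real (b e s) / 2 ^ s) \<longlonglongrightarrow> v"
      by (rule tendsto_sandwich[OF _ _ t_lim[of n, folded n(2)] tendsto_const]) (simp add: le)
    with le n show ?thesis by blast
  qed
  then obtain \<beta> where \<beta>: "\<And>e. \<beta> e \<in> range \<tau>" "\<And>e s. real (b e s) / 2 ^ s \<le> \<beta> e"
    "\<And>e. (\<lambda>s. real (b e s) / 2 ^ s) \<longlonglongrightarrow> \<beta> e"
    by metis
  have "left_re_numbering \<beta>"
    using rec_b \<beta>(2,3)
  proof (rule left_re_numberingI)
    show "\<beta> e \<in> {0..1}" for e using \<beta>(1)[of e] \<tau>(3) by auto
  qed
  moreover have False if "recursive f" and eq: "\<And>e. \<alpha> (f e) = \<beta> e" for f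
  proof -
    obtain r where r: "\<And>x. evaluates r [x] (f x)"
      using \<open>recursive f\<close> unfolding recursive_iff by blast
    \<comment> \<open>The diagonal point: \<open>f\<close> is applied to the code of an expression
      computing it.\<close>
    define e where "e = code r"
    obtain s0 where s0: "derived s0 e (ccons e 0) (f e)"
      using r[of e] unfolding evaluates_iff_derived by (auto simp: e_def)
    have unique: "i = f e" if "derived s e (ccons e 0) i" for s i
    proof -
      have "evaluates r [e] i"
        using that by (intro derived_sound(1)[of s]) (simp add: e_def)
      then show ?thesis
        using r by (rule evaluates_deterministic)
    qed
    obtain P where P: "\<forall>\<^sub>F s in sequentially. p e s = P"
      using bounded[of e] bounded_mono_eventually_const[OF p_mono] by metis
    have "(\<lambda>s. \<bar>real (a (f e) s) / 2 ^ s - real (b e s) / 2 ^ s\<bar>) \<longlonglongrightarrow> \<bar>\<alpha> (f e) - \<beta> e\<bar>"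
      by (rule tendsto_rabs[OF tendsto_diff[OF a(3) \<beta>(3)]])
    then have "\<forall>\<^sub>F s in sequentially. \<bar>real (a (f e) s) / 2 ^ s - real (b e s) / 2 ^ s\<bar> < 1 / 2 ^ P"
      by (rule order_tendstoD(2)) (simp add: eq)
    moreover have "\<forall>\<^sub>F s in sequentially. p e (Suc s) = P"
      using P by (subst eventually_sequentially_Suc)
    \<comment> \<open>At a late stage the test succeeds and pushes the phase beyond its final value
      \<open>P\<close>.\<close>
    ultimately have "\<forall>\<^sub>F s in sequentially. False"
      using P eventually_ge_at_top[of s0] eventually_gt_at_top[of "f e"]
    proof eventually_elim
      case (elim s)
      have "derived s e (ccons e 0) (f e)"
        using derived_mono[OF s0] elim by blast
      moreover have "\<bar>real (a i s) / 2 ^ s - real (b e s) / 2 ^ s\<bar> < 1 / 2 ^ p e s"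
        if "derived s e (ccons e 0) i" for i
        using unique[OF that] elim by simp
      ultimately have "follows e s (p e s)"
        unfolding follows_iff using elim by blast
      then show ?case
        using elim by (simp add: p_Suc)
    qed
    then show False by simp
  qed
  ultimately show ?thesis
    using \<beta>(1) by blast
qed

theorem theorem2p6:
  fixes C :: "real set"
  assumes "\<forall>r\<in>C. left_re r"
    and "\<exists>X. shift_persistent C X"
    and "\<not> (\<forall>R. infinite_real R \<and> left_re R \<and> 0 < R \<and> R < 1 \<longrightarrow> R \<in> C)"
  shows "\<not> (\<exists>\<alpha>. acceptable_left_re_numbering_of C \<alpha>)"
proof
  assume "\<exists>\<alpha>. acceptable_left_re_numbering_of C \<alpha>"
  then obtain \<alpha> where "acceptable_left_re_numbering_of C \<alpha>" ..
  then have \<alpha>: "left_re_numbering \<alpha>" "range \<alpha> = C"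
    and acceptable: "\<forall>\<beta>. left_re_numbering \<beta> \<and> range \<beta> \<subseteq> C \<longrightarrow> (\<exists>f. recursive f \<and> (\<forall>e. \<alpha> (f e) = \<beta> e))"
    unfolding acceptable_left_re_numbering_of_def left_re_numbering_of_def by simp_all
  from assms(2) obtain Y where Y: "\<And>\<sigma>. bin_real (\<sigma> \<frown> Y) \<in> C"
    unfolding shift_persistent_def by blast
  from assms(3) obtain R where R: "left_re R" "0 < R" "R < 1" "R \<notin> C" by blast
  define X where "X = bin_real Y"
  have "X \<in> C" using Y[of "[]"] by (simp add: X_def)
  then obtain i0 where i0: "\<alpha> i0 = X" using \<alpha>(2) by blast
  have X: "0 \<le> X" "X \<le> 1" using \<open>X \<in> C\<close> assms(1) by (auto simp: left_re_def)
  obtain a where a: "recursive2 a" "\<And>i s. real (a i s) / 2 ^ s \<le> \<alpha> i"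
    "\<And>i. (\<lambda>s. real (a i s) / 2 ^ s) \<longlonglongrightarrow> \<alpha> i"
    using left_re_numbering_approx[OF \<alpha>(1)] by blast
  obtain k where k: "recursive k" "\<And>n. real (k n) / 2 ^ n \<le> R" "(\<lambda>n. real (k n) / 2 ^ n) \<longlonglongrightarrow> R"
    using left_re_approx[OF R(1)] by blast
  have "\<forall>\<^sub>F n in sequentially. 0 < real (k n) / 2 ^ n"
    using k(3) R(2) by (rule order_tendstoD(1))
  \<comment> \<open>From \<open>n0\<close> on, \<open>k n - 1\<close> is not truncated; this is
    where \<open>0 < R\<close> enters.\<close>
  then obtain n0 where n0: "\<And>n. n \<ge> n0 \<Longrightarrow> 0 < k n"
    by (auto simp: eventually_sequentially zero_less_divide_iff)
  \<comment> \<open>The tail \<open>X\<close> adds at most one unit in the last place. Lowering the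
    numerator by one beforehand keeps \<open>\<tau> n\<close> at or below \<open>R\<close>, at a
    cost that tends to 0.\<close>
  define \<tau> where "\<tau> n = (real (k (n0 + n) - 1) + X) / 2 ^ (n0 + n)" for n
  \<comment> \<open>As a member of \<open>C\<close>, the tail has an index \<open>i0\<close> in
    \<open>\<alpha>\<close>, which supplies recursive approximations to it. The division rounds down
    to denominator \<open>2 ^ s\<close>, with an error of at most \<open>1 / 2 ^ s\<close>.\<close>
  define t where "t n s = ((k (n0 + n) - 1) * 2 ^ s + a i0 s) div 2 ^ (n0 + n)" for n s
  have \<tau>_eq: "\<tau> n = real (k (n0 + n)) / 2 ^ (n0 + n) - (1 - X) / 2 ^ (n0 + n)" for n
    using n0[of "n0 + n"] unfolding \<tau>_def by (simp add: of_nat_diff Suc_le_eq diff_divide_distrib add_divide_distrib)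
  have \<tau>_C: "\<tau> n \<in> C" for n
  proof -
    \<comment> \<open>By \<open>R < 1\<close> the numerator fits into \<open>n0 + n\<close> binary
      digits and so can serve as a prefix.\<close>
    have "real (k (n0 + n)) < 2 ^ (n0 + n)"
      using order_le_less_trans[OF k(2) R(3), of "n0 + n"] by (simp add: divide_less_eq)
    then have "real (k (n0 + n)) < real (2 ^ (n0 + n))" by simp
    then have "k (n0 + n) - 1 < 2 ^ (n0 + n)"
      unfolding of_nat_less_iff by linarith
    then obtain \<sigma> where "bin_real (\<sigma> \<frown> Y) = \<tau> n"
      using bin_real_prefix unfolding \<tau>_def X_def by blast
    with Y[of \<sigma>] show ?thesis by simp
  qed
  have t_real: "real ((k (n0 + n) - 1) * 2 ^ s + a i0 s) / 2 ^ (n0 + n) / 2 ^ s =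
      (real (k (n0 + n) - 1) + real (a i0 s) / 2 ^ s) / 2 ^ (n0 + n)" for n s
    by (simp add: field_simps)
  have t_le: "real (t n s) / 2 ^ s \<le> (real (k (n0 + n) - 1) + real (a i0 s) / 2 ^ s) / 2 ^ (n0 + n)" for n s
  proof -
    have "real (t n s) \<le> real ((k (n0 + n) - 1) * 2 ^ s + a i0 s) / 2 ^ (n0 + n)"
      unfolding t_def using of_nat_div_le_of_nat[of "(k (n0 + n) - 1) * 2 ^ s + a i0 s" "2 ^ (n0 + n)"] by simp
    then show ?thesis
      unfolding t_real[symmetric] by (rule divide_right_mono) simp
  qed
  have t_ge: "(real (k (n0 + n) - 1) + real (a i0 s) / 2 ^ s) / 2 ^ (n0 + n) - 1 / 2 ^ s \<le> real (t n s) / 2 ^ s" for n s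
  proof -
    have "real m / real d - 1 \<le> real (m div d)" for m d
      using floor_divide_of_nat_eq[where ?'a = real, of m d] by linarith
    from this[of "(k (n0 + n) - 1) * 2 ^ s + a i0 s" "2 ^ (n0 + n)"]
    have "real ((k (n0 + n) - 1) * 2 ^ s + a i0 s) / 2 ^ (n0 + n) - 1 \<le> real (t n s)"
      unfolding t_def by simp
    then have "(real ((k (n0 + n) - 1) * 2 ^ s + a i0 s) / 2 ^ (n0 + n) - 1) / 2 ^ s \<le> real (t n s) / 2 ^ s"
      by (rule divide_right_mono) simp
    then show ?thesis
      unfolding t_real[symmetric] by (simp add: diff_divide_distrib)
  qed
  obtain \<beta> where \<beta>: "left_re_numbering \<beta>" "range \<beta> \<subseteq> range \<tau>"
    "\<not> (\<exists>f. recursive f \<and> (\<forall>e. \<alpha> (f e) = \<beta> e))"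
  proof (atomize_elim, rule diagonal_numbering[OF \<alpha>(1), of R t \<tau>])
    show "R \<notin> range \<alpha>" using \<alpha>(2) R(4) by simp
    show "recursive2 t"
      unfolding t_def
      by (intro recursive2I recursive_intros recursive_compose[OF k(1)] recursive2_compose[OF a(1)])
    show "real (t n s) / 2 ^ s \<le> \<tau> n" for n s
    proof -
      have "(real (k (n0 + n) - 1) + real (a i0 s) / 2 ^ s) / 2 ^ (n0 + n) \<le> \<tau> n"
        unfolding \<tau>_def using a(2)[of i0 s] i0 by (intro divide_right_mono add_left_mono) auto
      with t_le[of n s] show ?thesis by simp
    qed
    show "(\<lambda>s. real (t n s) / 2 ^ s) \<longlonglongrightarrow> \<tau> n" for n
    proof -
      have upper: "(\<lambda>s. (real (k (n0 + n) - 1) + real (a i0 s) / 2 ^ s) / 2 ^ (n0 + n)) \<longlonglongrightarrow> \<tau> n"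
        unfolding \<tau>_def i0[symmetric]
        by (rule tendsto_divide[OF tendsto_add[OF tendsto_const a(3)] tendsto_const]) simp
      have "(\<lambda>s. (real (k (n0 + n) - 1) + real (a i0 s) / 2 ^ s) / 2 ^ (n0 + n) - 1 / 2 ^ s) \<longlonglongrightarrow> \<tau> n - 0"
        by (intro tendsto_diff upper LIMSEQ_divide_realpow_zero) simp
      then have lower: "(\<lambda>s. (real (k (n0 + n) - 1) + real (a i0 s) / 2 ^ s) / 2 ^ (n0 + n) - 1 / 2 ^ s) \<longlonglongrightarrow> \<tau> n"
        by simp
      show ?thesis
        by (rule tendsto_sandwich[OF _ _ lower upper]) (simp_all only: t_le t_ge eventually_True)
    qed
    show "\<tau> n \<le> R" for n
    proof -
      have "0 \<le> (1 - X) / 2 ^ (n0 + n)" using X(2) by simp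
      with k(2)[of "n0 + n"] show ?thesis unfolding \<tau>_eq by linarith
    qed
    have "(\<lambda>m. real (k m) / 2 ^ m - (1 - X) / 2 ^ m) \<longlonglongrightarrow> R - 0"
      by (intro tendsto_diff k(3) LIMSEQ_divide_realpow_zero) simp
    from LIMSEQ_ignore_initial_segment[OF this, of n0] show "\<tau> \<longlonglongrightarrow> R"
      unfolding \<tau>_eq[abs_def] by (simp add: add.commute)
    show "\<tau> n \<in> {0..1}" for n
      using \<tau>_C assms(1) by (auto simp: left_re_def)
  qed
  have "range \<beta> \<subseteq> C" using \<beta>(2) \<tau>_C by auto
  with \<beta>(1) have "\<exists>f. recursive f \<and> (\<forall>e. \<alpha> (f e) = \<beta> e)"
    using acceptable by simp
  with \<beta>(3) show False ..
qed

end
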